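(* Let $H$ be an infinite-dimensional separable Hilbert space over $\mathbb{K}\in\{\mathbb{R},\mathbb{C}\}$. For any (densely-defined, possibly unbounded) self-adjoint operator $A$ on $H$, there exists a projection-valued measure $P$ on $\operatorname{Borel}(\mathbb{R})$ such that $$A=\int_{\mathbb{R}}\operatorname{id}\, dP.$$
   Context: For a closed subspace $E$ of $H$, $\operatorname{proj}_E$ is the self-adjoint projection with image $E$. A function $P:\operatorname{Borel}(\mathbb{R})\to\{\operatorname{proj}_E : E\le H \text{ closed}\}$ is a projection-valued measure if $P(\emptyset)=0$, $P(\mathbb{R})=\operatorname{id}$; $P(V_1\cap V_2)=P(V_1)P(V_2)$ for all Borel $V_1,V_2$; and $P(\bigsqcup_{n}V_n)=\sum_{n\in\mathbb{N}}P(V_n)$ for every pairwise disjoint sequence $(V_n)_{n\in\mathbb{N}}$ of Borel sets (with convergence in the strong operator topology). For $x,y\in H$, $\mu_{x,y}$ is the $\mathbb{K}$-valued finite measure $V\mapsto(P(V)x,y)$; $\mu_{x,x}$ is positive. For Borel measurable $f:\mathbb{R}\to\mathbb{R}$, $\int_{\mathbb{R}}f\,dP$ is the (unique, densely-defined, self-adjoint) operator on $H$ with domain $\{x\in H:\int_{\mathbb{R}}|f|^2d\mu_{x,x}<\infty\}$ such that $(y,(\int_{\mathbb{R}}f\,dP)x)=\int_{\mathbb{R}}f\,d\mu_{y,x}$ for every $x$ in that domain and every $y\in H$. Here $\operatorname{id}$ is the function $t\mapsto t$ on $\mathbb{R}$. Equality of operators includes equality of domains. *)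

theory Defs
  imports "HOL-Analysis.Analysis"
begin

text \<open>
  The class contains, up to isomorphism, exactly the two fields \<^typ>\<open>real\<close> and \<^typ>\<open>complex\<close>:
  a member is a field embedded in the complex numbers whose image is one of the two.
\<close>

class real_or_complex = field +
  fixes emb :: "'a \<Rightarrow> complex"
  assumes emb_add: "emb (a + b) = emb a + emb b"
    and emb_mult: "emb (a * b) = emb a * emb b"
    and inj_emb: "inj emb"
    and range_emb: "range emb = \<real> \<or> range emb = UNIV"

instantiation real :: real_or_complex
begin
definition emb_real :: "real \<Rightarrow> complex" where "emb_real = complex_of_real"
instance
  by standard (auto simp: emb_real_def inj_on_def Reals_def)
end

instantiation complex :: real_or_complex
begin
definition emb_complex :: "complex \<Rightarrow> complex" where "emb_complex = id"
instance
  by standard (auto simp: emb_complex_def)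
end

text \<open>
  A finite real or complex measure is given as a countably additive set function.
  Its integral is defined through the Jordan decomposition: the positive part of \<open>\<nu>\<close> is
  \<open>V \<mapsto> sup {\<nu> W | W \<subseteq> V}\<close>, the negative part is the positive part of \<open>- \<nu>\<close>.
  Note that \<^const>\<open>ennreal\<close> sends negative numbers to \<open>0\<close>, which does not affect the
  supremum since \<open>\<nu> {} = 0\<close>.
\<close>

definition positive_part :: "(real set \<Rightarrow> real) \<Rightarrow> real measure" where
  "positive_part \<nu> = measure_of UNIV (sets borel)
     (\<lambda>V. SUP W\<in>{W \<in> sets borel. W \<subseteq> V}. ennreal (\<nu> W))"

definition negative_part :: "(real set \<Rightarrow> real) \<Rightarrow> real measure" where
  "negative_part \<nu> = positive_part (\<lambda>V. - \<nu> V)"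

definition has_signed_integral :: "(real \<Rightarrow> real) \<Rightarrow> (real set \<Rightarrow> real) \<Rightarrow> real \<Rightarrow> bool" where
  "has_signed_integral f \<nu> c \<longleftrightarrow>
     integrable (positive_part \<nu>) f \<and> integrable (negative_part \<nu>) f \<and>
     c = (LINT t|positive_part \<nu>. f t) - (LINT t|negative_part \<nu>. f t)"

definition has_cmeasure_integral :: "(real \<Rightarrow> real) \<Rightarrow> (real set \<Rightarrow> complex) \<Rightarrow> complex \<Rightarrow> bool" where
  "has_cmeasure_integral f \<nu> c \<longleftrightarrow>
     has_signed_integral f (\<lambda>V. Re (\<nu> V)) (Re c) \<and>
     has_signed_integral f (\<lambda>V. Im (\<nu> V)) (Im c)"

text \<open>
  A Hilbert space over the scalars \<^typ>\<open>'k\<close> is a real Hilbert space (which fixes the norm and the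
  topology) with a scalar multiplication extending the real one and a \<^typ>\<open>'k\<close>-valued inner
  product \<open>ip\<close>, linear in the first argument, whose real part is the real inner product; hence
  \<open>ip x x\<close> is the squared norm of \<open>x\<close>. For real scalars, \<open>ip\<close> is \<^const>\<open>inner\<close>.
\<close>

locale hilbert_space = vector_space scale
  for scale :: "'k::real_or_complex \<Rightarrow> 'h::{real_inner, complete_space} \<Rightarrow> 'h" +
  fixes ip :: "'h \<Rightarrow> 'h \<Rightarrow> 'k"
  assumes scale_real: "emb a = complex_of_real r \<Longrightarrow> scale a x = r *\<^sub>R x"
    and ip_add_left: "ip (x + y) z = ip x z + ip y z"
    and ip_scale_left: "ip (scale a x) y = a * ip x y"
    and ip_commute: "emb (ip y x) = cnj (emb (ip x y))"
    and Re_ip: "Re (emb (ip x y)) = inner x y"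
begin

definition infinite_dimensional :: bool where
  "infinite_dimensional \<longleftrightarrow> (\<nexists>B. finite B \<and> span B = UNIV)"

text \<open>
  An operator is a partial map, so that equality of operators includes equality of domains.
\<close>

definition linear_operator :: "('h \<rightharpoonup> 'h) \<Rightarrow> bool" where
  "linear_operator A \<longleftrightarrow> subspace (dom A) \<and>
     (\<forall>x\<in>dom A. \<forall>y\<in>dom A. the (A (x + y)) = the (A x) + the (A y)) \<and>
     (\<forall>a. \<forall>x\<in>dom A. the (A (scale a x)) = scale a (the (A x)))"

definition densely_defined :: "('h \<rightharpoonup> 'h) \<Rightarrow> bool" where
  "densely_defined A \<longleftrightarrow> closure (dom A) = UNIV"

definition adjoint_witness :: "('h \<rightharpoonup> 'h) \<Rightarrow> 'h \<Rightarrow> 'h \<Rightarrow> bool" where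
  "adjoint_witness A y z \<longleftrightarrow> (\<forall>x\<in>dom A. ip (the (A x)) y = ip x z)"

text \<open>For densely defined \<open>A\<close> the witness is unique.\<close>

definition adjoint_operator :: "('h \<rightharpoonup> 'h) \<Rightarrow> 'h \<rightharpoonup> 'h" where
  "adjoint_operator A = (\<lambda>y. if \<exists>z. adjoint_witness A y z then Some (THE z. adjoint_witness A y z) else None)"

definition self_adjoint :: "('h \<rightharpoonup> 'h) \<Rightarrow> bool" where
  "self_adjoint A \<longleftrightarrow> linear_operator A \<and> densely_defined A \<and> adjoint_operator A = A"

definition is_proj :: "'h set \<Rightarrow> ('h \<Rightarrow> 'h) \<Rightarrow> bool" where
  "is_proj E T \<longleftrightarrow> Vector_Spaces.linear scale scale T \<and> T \<circ> T = T \<and>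
     (\<forall>x y. ip (T x) y = ip x (T y)) \<and> range T = E"

definition projection_valued_measure :: "(real set \<Rightarrow> 'h \<Rightarrow> 'h) \<Rightarrow> bool" where
  "projection_valued_measure P \<longleftrightarrow>
     (\<forall>V\<in>sets borel. \<exists>E. subspace E \<and> closed E \<and> is_proj E (P V)) \<and>
     P {} = (\<lambda>x. 0) \<and> P UNIV = id \<and>
     (\<forall>V\<in>sets borel. \<forall>W\<in>sets borel. P (V \<inter> W) = P V \<circ> P W) \<and>
     (\<forall>V :: nat \<Rightarrow> real set. range V \<subseteq> sets borel \<longrightarrow> disjoint_family V \<longrightarrow>
        (\<forall>x. (\<lambda>n. P (V n) x) sums P (\<Union>n. V n) x))"

definition pvm_measure :: "(real set \<Rightarrow> 'h \<Rightarrow> 'h) \<Rightarrow> 'h \<Rightarrow> 'h \<Rightarrow> real set \<Rightarrow> 'k" where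
  "pvm_measure P x y V = ip (P V x) y"

text \<open>The positive measure \<open>pvm_measure P x x\<close> as a library measure.\<close>

definition pvm_pos_measure :: "(real set \<Rightarrow> 'h \<Rightarrow> 'h) \<Rightarrow> 'h \<Rightarrow> real measure" where
  "pvm_pos_measure P x =
     measure_of UNIV (sets borel) (\<lambda>V. ennreal (Re (emb (pvm_measure P x x V))))"

definition is_pvm_integral :: "(real set \<Rightarrow> 'h \<Rightarrow> 'h) \<Rightarrow> (real \<Rightarrow> real) \<Rightarrow> ('h \<rightharpoonup> 'h) \<Rightarrow> bool" where
  "is_pvm_integral P f B \<longleftrightarrow> self_adjoint B \<and>
     dom B = {x. (\<integral>\<^sup>+t. ennreal (\<bar>f t\<bar>\<^sup>2) \<partial>pvm_pos_measure P x) < \<infinity>} \<and>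
     (\<forall>x\<in>dom B. \<forall>y.
        has_cmeasure_integral f (\<lambda>V. emb (pvm_measure P y x V)) (emb (ip y (the (B x)))))"

definition pvm_integral :: "(real set \<Rightarrow> 'h \<Rightarrow> 'h) \<Rightarrow> (real \<Rightarrow> real) \<Rightarrow> 'h \<rightharpoonup> 'h" where
  "pvm_integral P f = (THE B. is_pvm_integral P f B)"

lemma is_pvm_integral_unique:
  assumes "is_pvm_integral P f B" "is_pvm_integral P f C"
  shows "B = C"
proof (rule map_le_antisym)
  have *: "B \<subseteq>\<^sub>m C" if B: "is_pvm_integral P f B" and C: "is_pvm_integral P f C" for B C
    unfolding map_le_def
  proof
    fix x assume x: "x \<in> dom B"
    then have x': "x \<in> dom C"
      using B C unfolding is_pvm_integral_def by simp
    have "inner y (the (B x)) = inner y (the (C x))" for y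
      using B C x x' unfolding is_pvm_integral_def has_cmeasure_integral_def
        has_signed_integral_def Re_ip[symmetric] by metis
    then have "the (B x) = the (C x)"
      using vector_eq_ldot by blast
    then show "B x = C x"
      using x x' by force
  qed
  show "B \<subseteq>\<^sub>m C" "C \<subseteq>\<^sub>m B"
    using * assms by blast+
qed

lemma pvm_integral_eqI: "is_pvm_integral P f B \<Longrightarrow> pvm_integral P f = B"
  unfolding pvm_integral_def by (blast intro: is_pvm_integral_unique)

end

lemma hilbert_space_real:
  "hilbert_space (scaleR :: real \<Rightarrow> 'h::{real_inner, complete_space} \<Rightarrow> 'h) inner"
  by unfold_locales (auto simp: emb_real_def algebra_simps inner_commute)

lemma hilbert_space_complex: "hilbert_space ((*) :: complex \<Rightarrow> _) (\<lambda>x y. x * cnj y)"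
  by unfold_locales (auto simp: emb_complex_def algebra_simps scaleR_conv_of_real inner_complex_def)

end

theory Submission
  imports Defs
begin

text \<open>
  Only the underlying real Hilbert space matters: everything constructed from \<open>A\<close> commutes with all
  bounded operators \<open>U\<close> such that \<open>U\<close> and its adjoint commute with \<open>A\<close>, in particular with the
  scalars of \<open>'k\<close>.

  For a bounded self-adjoint \<open>S\<close>, the projection onto the kernel of \<open>\<bar>S\<bar> + S\<close> splits the space into
  a part where \<open>S \<le> 0\<close> and a part where \<open>S \<ge> 0\<close>. Applied to \<open>(A - c) / (1 + (A - c)\<^sup>2)\<close>, which is
  bounded and has the sign of \<open>A - c\<close>, this gives the spectral family \<open>E c\<close>. The distribution
  functions \<open>c \<mapsto> (E c x, x)\<close> define measures \<open>\<mu>\<^sub>x\<close>, and the Borel sets \<open>V\<close> for which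
  \<open>x \<mapsto> \<mu>\<^sub>x V\<close> is the quadratic form of a projection form a Dynkin system containing the half-open
  intervals.

  On the range of \<open>P {c - h<..c}\<close> the operator \<open>A\<close> is within \<open>h\<close> of \<open>c\<close>. Summing over a grid of
  width \<open>1\<close> identifies the domain of \<open>A\<close>, and letting the width tend to \<open>0\<close> identifies its values.
\<close>

section \<open>Orthogonal projections\<close>

text \<open>Real scalars offer no resolvent at a nonreal point, so bounded functions of
  \<open>A\<close> are obtained from \<open>1 / (1 + A^2)\<close>, which comes from an orthogonal
  projection onto the graph of \<open>A\<close>. The projections \<open>E c\<close> are chosen
  separately for each \<open>c\<close>, with no functional calculus behind them. Two things tie them
  together: membership in one bicommutant makes them commute, and form bounds for \<open>A\<close>
  on their ranges and kernels make them ordered, right-continuous and exhaustive. The kernel of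
  \<open>A - c\<close> is assigned to \<open>E c\<close>; this tie-break gives right continuity and
  dictates intervals open on the left. Since the total mass of the measure at \<open>x\<close> is
  the squared norm of \<open>x\<close>, projections belonging to disjoint sets are orthogonal, and
  multiplicativity follows from that without a second Dynkin argument. The integral against a signed
  measure is defined by suprema over subsets; a Hahn set, found after polarisation, turns these
  suprema into explicit values.\<close>

lemma convergent_of_square_norm:
  fixes u :: "nat \<Rightarrow> 'a::{real_normed_vector, complete_space}"
  assumes "\<And>e. e > 0 \<Longrightarrow> \<exists>N. \<forall>n\<ge>N. \<forall>m\<ge>n. (norm (u m - u n))\<^sup>2 < e"
  shows "convergent u"
proof -
  have "Cauchy u"
  proof (rule CauchyI)
    fix e :: real assume e: "e > 0"
    then obtain N where N: "\<And>m n. N \<le> n \<Longrightarrow> n \<le> m \<Longrightarrow> (norm (u m - u n))\<^sup>2 < e\<^sup>2"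
      using assms[of "e\<^sup>2"] by auto
    have "norm (u m - u n) < e" if "N \<le> n" "n \<le> m" for m n
      using N[OF that] e by (simp add: power2_less_imp_less)
    then show "\<exists>N. \<forall>m\<ge>N. \<forall>n\<ge>N. norm (u m - u n) < e"
      by (metis linorder_le_cases norm_minus_commute)
  qed
  then show ?thesis by (simp add: Cauchy_convergent_iff)
qed

text \<open>The scalar sequence \<open>c\<close> is a monotone bounded one in each use: squared
  norms of projections, the scalar iteration for the square root, partial sums of squared norms.
  Pythagoras produces squares on the left, hence this form.\<close>

lemma convergent_of_square_bound:
  fixes u :: "nat \<Rightarrow> 'a::{real_normed_vector, complete_space}"
  assumes "convergent c"
    and "\<And>m n. n \<le> m \<Longrightarrow> (norm (u m - u n))\<^sup>2 \<le> \<bar>c m - c n :: real\<bar>"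
  shows "convergent u"
proof (rule convergent_of_square_norm)
  fix e :: real assume "e > 0"
  then obtain N where "\<And>m n. m \<ge> N \<Longrightarrow> n \<ge> N \<Longrightarrow> \<bar>c m - c n\<bar> < e"
    using assms(1) convergent_Cauchy CauchyD by (metis real_norm_def)
  then show "\<exists>N. \<forall>n\<ge>N. \<forall>m\<ge>n. (norm (u m - u n))\<^sup>2 < e"
    using assms(2) by (meson le_less_trans le_trans)
qed

lemma orthogonal_decomposition:
  fixes M :: "'a::{real_inner, complete_space} set"
  assumes "subspace M" "closed M"
  obtains p where "p \<in> M" "\<And>z. z \<in> M \<Longrightarrow> inner (x - p) z = 0"
proof -
  define q where "q z = (norm (x - z))\<^sup>2" for z
  define d where "d = Inf (q ` M)"
  have bdd: "bdd_below (q ` M)" unfolding q_def by (rule bdd_belowI[of _ 0]) auto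
  have ne: "M \<noteq> {}" using assms(1) subspace_0 by blast
  have d_le: "d \<le> q z" if "z \<in> M" for z
    unfolding d_def using bdd that by (simp add: cInf_lower)
  have "\<exists>z\<in>M. q z < d + e" if "e > 0" for e
    using cInf_lessD[of "q ` M" "d + e"] ne that unfolding d_def by auto
  then have "\<exists>z. \<forall>n. z n \<in> M \<and> q (z n) < d + inverse (real (Suc n))"
    by (intro choice) (metis inverse_positive_iff_positive of_nat_0_less_iff zero_less_Suc)
  then obtain z where z: "\<And>n. z n \<in> M" "\<And>n. q (z n) < d + inverse (real (Suc n))" by blast
  have parallelogram: "(norm (z m - z n))\<^sup>2 \<le> 4 * inverse (real (Suc n))" if "n \<le> m" for m n
  proof -
    have mid: "(1/2) *\<^sub>R (z m + z n) \<in> M"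
      using assms(1) z(1) by (simp add: subspace_add subspace_scale)
    \<comment> \<open>Parallelogram law. The midpoint stays in \<open>M\<close>, so its squared
      distance to \<open>x\<close> is at least \<open>d\<close>, which makes every minimising
      sequence Cauchy.\<close>
    have "(norm (z m - z n))\<^sup>2 = 2 * q (z m) + 2 * q (z n) - 4 * q ((1/2) *\<^sub>R (z m + z n))"
      unfolding q_def power2_norm_eq_inner
      by (simp add: inner_diff_left inner_diff_right inner_add_left inner_add_right inner_commute
          algebra_simps)
    also have "\<dots> \<le> 2 * inverse (real (Suc m)) + 2 * inverse (real (Suc n))"
      using d_le[OF mid] z(2)[of m] z(2)[of n] by linarith
    also have "inverse (real (Suc m)) \<le> inverse (real (Suc n))"
      using that by (simp add: le_imp_inverse_le)
    finally show ?thesis by simp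
  qed
  have "convergent z"
  proof (rule convergent_of_square_norm)
    fix e :: real assume "e > 0"
    then obtain N where N: "inverse (real (Suc N)) < e / 4"
      using reals_Archimedean[of "e / 4"] by auto
    have "(norm (z m - z n))\<^sup>2 < e" if "N \<le> n" "n \<le> m" for m n
    proof -
      have "inverse (real (Suc n)) \<le> inverse (real (Suc N))"
        using that by (simp add: le_imp_inverse_le)
      then show ?thesis using parallelogram[OF that(2)] N by linarith
    qed
    then show "\<exists>N. \<forall>n\<ge>N. \<forall>m\<ge>n. (norm (z m - z n))\<^sup>2 < e" by blast
  qed
  then obtain p where p: "z \<longlonglongrightarrow> p"
    unfolding convergent_def by blast
  have pM: "p \<in> M" using p z(1) assms(2) closed_sequentially by blast
  have "(\<lambda>n. q (z n)) \<longlonglongrightarrow> q p" unfolding q_def by (intro tendsto_intros p)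
  moreover have "(\<lambda>n. d + inverse (real (Suc n))) \<longlonglongrightarrow> d + 0"
    by (intro tendsto_intros LIMSEQ_inverse_real_of_nat)
  ultimately have "q p \<le> d + 0"
    by (rule LIMSEQ_le) (use z(2) in \<open>auto intro: less_imp_le\<close>)
  then have qp: "q p \<le> d" by simp
  have "inner (x - p) w = 0" if w: "w \<in> M" for w
  proof (cases "w = 0")
    case False
    \<comment> \<open>The minimiser of the quadratic polynomial
      \<open>s \<mapsto> q (p + s *\<^sub>R w)\<close>; minimality of \<open>p\<close> forces its
      linear coefficient to vanish.\<close>
    define t where "t = inner (x - p) w / inner w w"
    have "p + t *\<^sub>R w \<in> M" using assms(1) pM w by (simp add: subspace_add subspace_scale)
    then have "q p \<le> q (p + t *\<^sub>R w)" using d_le qp by force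
    moreover have "q (p + t *\<^sub>R w) = q p - 2 * t * inner (x - p) w + t * t * inner w w"
      unfolding q_def power2_norm_eq_inner
      by (simp add: inner_diff_left inner_diff_right inner_add_left inner_add_right inner_commute
          algebra_simps)
    moreover have tw: "t * inner w w = inner (x - p) w" unfolding t_def using False by simp
    ultimately have "t * inner (x - p) w \<le> 0" by (simp only: mult.assoc)
    then have "(t * inner w w) * inner (x - p) w \<le> 0"
      by (metis inner_ge_zero mult.assoc mult.commute mult_nonneg_nonpos)
    then have "inner (x - p) w * inner (x - p) w \<le> 0"
      using tw by simp
    then show ?thesis by (metis mult_eq_0_iff order_antisym zero_le_square)
  qed simp
  then show thesis using that pM by blast
qed

section \<open>Adjoint pairs and the algebra of orthogonal projections\<close>

definition adjoint_pair :: "('a::real_inner \<Rightarrow> 'b::real_inner) \<Rightarrow> ('b \<Rightarrow> 'a) \<Rightarrow> bool" where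
  "adjoint_pair U U' \<longleftrightarrow> (\<forall>x y. inner (U x) y = inner x (U' y))"

definition orth_proj :: "('a::real_inner \<Rightarrow> 'a) \<Rightarrow> bool" where
  "orth_proj P \<longleftrightarrow> adjoint_pair P P \<and> (\<forall>x. P (P x) = P x)"

lemma adjoint_pairD: "adjoint_pair U U' \<Longrightarrow> inner (U x) y = inner x (U' y)"
  unfolding adjoint_pair_def by blast

lemma adjoint_pair_sym: "adjoint_pair U U' \<Longrightarrow> adjoint_pair U' U"
  unfolding adjoint_pair_def by (metis inner_commute)

lemma adjoint_pair_linear:
  assumes "adjoint_pair U U'"
  shows "linear U"
proof (rule linearI)
  show "U (x + y) = U x + U y" for x y
    by (rule vector_eq_rdot[THEN iffD1]) (simp add: adjoint_pairD[OF assms] inner_add_left)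
  show "U (c *\<^sub>R x) = c *\<^sub>R U x" for c x
    by (rule vector_eq_rdot[THEN iffD1]) (simp add: adjoint_pairD[OF assms])
qed

text \<open>Having an everywhere defined adjoint stands in for continuity: moving \<open>U\<close>
  to the other side of the inner product identifies the limit weakly. This is how commutation with
  \<open>U\<close> survives strong limits without a norm bound on \<open>U\<close>.\<close>

lemma adjoint_pair_weak_limit:
  assumes "adjoint_pair U U'" "(u \<longlongrightarrow> x) F" "((\<lambda>n. U (u n)) \<longlongrightarrow> z) F" "F \<noteq> bot"
  shows "U x = z"
proof (rule vector_eq_rdot[THEN iffD1], rule allI)
  fix y
  have "((\<lambda>n. inner (U (u n)) y) \<longlongrightarrow> inner z y) F" by (intro tendsto_intros assms)
  moreover have "((\<lambda>n. inner (U (u n)) y) \<longlongrightarrow> inner (U x) y) F"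
    unfolding adjoint_pairD[OF assms(1)] by (intro tendsto_intros assms)
  ultimately show "inner (U x) y = inner z y" using assms(4) tendsto_unique by blast
qed

lemma orth_proj_adj: "orth_proj P \<Longrightarrow> adjoint_pair P P"
  and orth_proj_idem: "orth_proj P \<Longrightarrow> P (P x) = P x"
  and orth_proj_linear: "orth_proj P \<Longrightarrow> linear P"
  unfolding orth_proj_def using adjoint_pair_linear by blast+

lemma orth_proj_inner: "orth_proj P \<Longrightarrow> inner (P x) y = inner x (P y)"
  using adjoint_pairD orth_proj_adj by blast

lemma orth_proj_inner_self: "orth_proj P \<Longrightarrow> inner (P x) x = (norm (P x))\<^sup>2"
  by (metis orth_proj_idem orth_proj_inner power2_norm_eq_inner)

lemma orth_proj_inner_both: "orth_proj P \<Longrightarrow> inner (P x) (P y) = inner (P x) y"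
  by (metis orth_proj_idem orth_proj_inner)

lemma orth_proj_norm_le:
  assumes "orth_proj P"
  shows "norm (P x) \<le> norm x"
proof -
  have "norm (P x) * norm (P x) \<le> norm (P x) * norm x"
    using orth_proj_inner_self[OF assms, of x] norm_cauchy_schwarz[of "P x" x]
    by (simp add: power2_eq_square)
  then show ?thesis by (cases "P x = 0") auto
qed

lemma orth_proj_bounded_linear: "orth_proj P \<Longrightarrow> bounded_linear P"
  by (intro bounded_linear_intro[where K = 1])
    (auto simp: orth_proj_norm_le linear_add linear_scale dest: orth_proj_linear)

lemma orth_proj_tendsto: "orth_proj P \<Longrightarrow> (u \<longlongrightarrow> x) F \<Longrightarrow> ((\<lambda>n. P (u n)) \<longlongrightarrow> P x) F"
  using bounded_linear.tendsto orth_proj_bounded_linear by blast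

lemma orth_proj_0: "orth_proj (\<lambda>x. 0)"
  and orth_proj_id: "orth_proj (\<lambda>x. x)"
  unfolding orth_proj_def adjoint_pair_def by auto

lemma orth_proj_compl: "orth_proj P \<Longrightarrow> orth_proj (\<lambda>x. x - P x)"
  unfolding orth_proj_def adjoint_pair_def
  by (auto simp: inner_diff_left inner_diff_right linear_diff[OF orth_proj_linear]
      orth_proj_def adjoint_pair_def)

lemma orth_proj_zero_swap:
  assumes "orth_proj P" "orth_proj Q" "\<And>x. P (Q x) = 0"
  shows "Q (P x) = 0"
  by (metis assms inner_eq_zero_iff inner_zero_right orth_proj_inner)

lemma orth_proj_plus:
  assumes P: "orth_proj P" and Q: "orth_proj Q" and 0: "\<And>x. P (Q x) = 0"
  shows "orth_proj (\<lambda>x. P x + Q x)"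
  using orth_proj_zero_swap[OF P Q 0] 0 orth_proj_idem[OF P] orth_proj_idem[OF Q]
  unfolding orth_proj_def adjoint_pair_def
  by (simp add: inner_add_left inner_add_right orth_proj_inner[OF P] orth_proj_inner[OF Q]
      linear_add[OF orth_proj_linear[OF P]] linear_add[OF orth_proj_linear[OF Q]])

lemma orth_proj_minus:
  assumes P: "orth_proj P" and Q: "orth_proj Q" and PQ: "\<And>x. P (Q x) = Q x"
  shows "orth_proj (\<lambda>x. P x - Q x)"
proof -
  \<comment> \<open>The adjoint of the relation \<open>P Q = Q\<close>.\<close>
  have "Q (P x) = Q x" for x
    by (rule vector_eq_rdot[THEN iffD1]) (simp add: orth_proj_inner[OF P] orth_proj_inner[OF Q] PQ)
  then show ?thesis
    unfolding orth_proj_def adjoint_pair_def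
    by (simp add: inner_diff_left inner_diff_right orth_proj_inner[OF P] orth_proj_inner[OF Q]
        linear_diff[OF orth_proj_linear[OF P]] linear_diff[OF orth_proj_linear[OF Q]]
        orth_proj_idem[OF P] orth_proj_idem[OF Q] PQ)
qed

lemma orth_proj_comp:
  assumes P: "orth_proj P" and Q: "orth_proj Q" and comm: "\<And>x. P (Q x) = Q (P x)"
  shows "orth_proj (\<lambda>x. P (Q x))"
  unfolding orth_proj_def adjoint_pair_def
  by (metis P Q comm orth_proj_idem orth_proj_inner)

text \<open>On the range of \<open>P\<close> equal forms mean that \<open>Q\<close> preserves norms,
  and a projection fixes every vector whose norm it preserves. So each projection fixes the range of
  the other. This makes a projection recoverable from scalar measures.\<close>

lemma orth_proj_eqI:
  assumes P: "orth_proj P" and Q: "orth_proj Q" and eq: "\<And>x. inner (P x) x = inner (Q x) x"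
  shows "P = Q"
proof
  fix x
  have "norm (P x - Q (P x)) ^ 2 = (norm (P x))\<^sup>2 - (norm (Q (P x)))\<^sup>2"
    unfolding power2_norm_eq_inner
    by (simp add: inner_diff_left inner_diff_right orth_proj_inner_both[OF Q] inner_commute)
  also have "\<dots> = 0"
    using eq[of "P x"] orth_proj_inner_self[OF Q, of "P x"]
    by (simp add: P orth_proj_idem power2_norm_eq_inner)
  finally have *: "Q (P x) = P x" by simp
  have "norm (Q x - P (Q x)) ^ 2 = (norm (Q x))\<^sup>2 - (norm (P (Q x)))\<^sup>2"
    unfolding power2_norm_eq_inner
    by (simp add: inner_diff_left inner_diff_right orth_proj_inner_both[OF P] inner_commute)
  also have "\<dots> = 0"
    using eq[of "Q x"] orth_proj_inner_self[OF P, of "Q x"]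
    by (simp add: Q orth_proj_idem power2_norm_eq_inner)
  finally have **: "P (Q x) = Q x" by simp
  have "norm (P x - Q x) ^ 2 = inner (P x) x - 2 * inner (P x) (Q x) + inner (Q x) x"
    unfolding power2_norm_eq_inner
    by (simp add: inner_diff_left inner_diff_right orth_proj_inner_both P Q inner_commute)
  also have "inner (P x) (Q x) = inner (P x) x"
    by (metis * Q orth_proj_inner)
  also have "inner (P x) x = inner (Q x) x" by (rule eq)
  finally show "P x = Q x" by simp
qed

lemma orth_proj_exists:
  fixes M :: "'a::{real_inner, complete_space} set"
  assumes "subspace M" "closed M"
  obtains P where "orth_proj P" "\<And>x. P x \<in> M" "\<And>x. x \<in> M \<Longrightarrow> P x = x"
    "\<And>x z. z \<in> M \<Longrightarrow> inner (x - P x) z = 0"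
proof -
  have "\<forall>x. \<exists>p. p \<in> M \<and> (\<forall>z\<in>M. inner (x - p) z = 0)"
    using orthogonal_decomposition[OF assms] by metis
  then obtain P where P: "\<And>x. P x \<in> M" "\<And>x z. z \<in> M \<Longrightarrow> inner (x - P x) z = 0" by metis
  have fixp: "P x = x" if "x \<in> M" for x
  proof -
    have "inner (x - P x) (x - P x) = 0"
      using P that assms(1) subspace_diff by blast
    then show ?thesis by simp
  qed
  moreover have "adjoint_pair P P"
    unfolding adjoint_pair_def
  proof (intro allI)
    fix x y
    have "inner (x - P x) (P y) = 0" "inner (y - P y) (P x) = 0" using P by blast+
    then show "inner (P x) y = inner x (P y)"
      by (metis eq_iff_diff_eq_0 inner_commute inner_diff_left)
  qed
  ultimately show thesis using that P unfolding orth_proj_def by blast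
qed

text \<open>Invariance of \<open>M\<close> under \<open>U\<close> gives \<open>U P = P U P\<close>,
  invariance under \<open>U'\<close> gives \<open>P U = P U P\<close> after taking adjoints.\<close>

lemma orth_proj_commute:
  assumes P: "orth_proj P" and ran: "\<And>x. P x \<in> M" and fixp: "\<And>x. x \<in> M \<Longrightarrow> P x = x"
    and U: "adjoint_pair U U'" and inv: "\<And>x. x \<in> M \<Longrightarrow> U x \<in> M" "\<And>x. x \<in> M \<Longrightarrow> U' x \<in> M"
  shows "P (U x) = U (P x)"
proof (rule vector_eq_rdot[THEN iffD1], rule allI)
  fix y
  have "inner (P (U x)) y = inner x (U' (P y))"
    by (simp add: orth_proj_inner[OF P] adjoint_pairD[OF U])
  also have "\<dots> = inner x (P (U' (P y)))"
    by (simp add: fixp[OF inv(2)[OF ran]])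
  also have "\<dots> = inner (U (P x)) (P y)"
    by (simp add: adjoint_pairD[OF U] orth_proj_inner[OF P])
  also have "\<dots> = inner (P (U (P x))) y"
    by (simp add: orth_proj_inner[OF P])
  finally show "inner (P (U x)) y = inner (U (P x)) y"
    by (simp add: fixp[OF inv(1)[OF ran]])
qed

text \<open>Idempotence passes to the limit in the form
  \<open>inner (P n x) (P n y) = inner (P n x) y\<close>, which avoids the double limit in
  \<open>P n (P n x)\<close>.\<close>

lemma orth_proj_limit:
  assumes P: "\<And>n. orth_proj (P n)" and lim: "\<And>x. (\<lambda>n. P n x) \<longlonglongrightarrow> Q x"
  shows "orth_proj Q"
proof -
  have sym: "inner (Q x) y = inner x (Q y)" for x y
  proof -
    have "(\<lambda>n. inner (P n x) y) \<longlonglongrightarrow> inner (Q x) y" by (intro tendsto_intros lim)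
    moreover have "(\<lambda>n. inner (P n x) y) \<longlonglongrightarrow> inner x (Q y)"
      unfolding orth_proj_inner[OF P] by (intro tendsto_intros lim)
    ultimately show ?thesis using LIMSEQ_unique by blast
  qed
  have "inner (Q (Q x)) y = inner (Q x) y" for x y
  proof -
    have "(\<lambda>n. inner (P n x) (P n y)) \<longlonglongrightarrow> inner (Q x) (Q y)" by (intro tendsto_intros lim)
    moreover have "(\<lambda>n. inner (P n x) (P n y)) \<longlonglongrightarrow> inner (Q x) y"
      unfolding orth_proj_inner_both[OF P] by (intro tendsto_intros lim)
    ultimately show ?thesis using LIMSEQ_unique sym by metis
  qed
  then show ?thesis unfolding orth_proj_def adjoint_pair_def using sym vector_eq_rdot by blast
qed

text \<open>Increments are orthogonal, so their squared norms are differences of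
  \<open>(norm (P n x))^2\<close>, a monotone sequence bounded by \<open>(norm x)^2\<close>.\<close>

lemma orth_proj_increasing_limit:
  fixes P :: "nat \<Rightarrow> 'a::{real_inner, complete_space} \<Rightarrow> 'a"
  assumes P: "\<And>n. orth_proj (P n)" and mono: "\<And>m n x. n \<le> m \<Longrightarrow> P m (P n x) = P n x"
  shows "\<exists>Q. orth_proj Q \<and> (\<forall>x. (\<lambda>n. P n x) \<longlonglongrightarrow> Q x)"
proof -
  have "convergent (\<lambda>n. P n x)" for x
  proof -
    have eq: "(norm (P m x - P n x))\<^sup>2 = (norm (P m x))\<^sup>2 - (norm (P n x))\<^sup>2" if "n \<le> m" for m n
    proof -
      have "inner (P m x) (P n x) = inner (P n x) (P n x)"
        by (metis P mono orth_proj_inner orth_proj_inner_both inner_commute that)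
      then show ?thesis
        unfolding power2_norm_eq_inner by (simp add: inner_diff_left inner_diff_right inner_commute)
    qed
    have "incseq (\<lambda>n. (norm (P n x))\<^sup>2)"
      unfolding incseq_def using eq by (smt (verit) zero_le_power2)
    moreover have "(norm (P n x))\<^sup>2 \<le> (norm x)\<^sup>2" for n
      using orth_proj_norm_le[OF P] by (simp add: power_mono)
    ultimately have "convergent (\<lambda>n. (norm (P n x))\<^sup>2)"
      by (meson convergent_def incseq_convergent)
    then show ?thesis
      by (rule convergent_of_square_bound) (simp add: eq)
  qed
  then obtain Q where Q: "\<And>x. (\<lambda>n. P n x) \<longlonglongrightarrow> Q x" unfolding convergent_def by metis
  then show ?thesis using orth_proj_limit[OF P Q] by blast
qed

section \<open>The sign of a bounded self-adjoint operator\<close>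

primrec sqrt_step :: "('a \<Rightarrow> 'a) \<Rightarrow> nat \<Rightarrow> 'a::real_vector \<Rightarrow> 'a" where
  "sqrt_step X 0 = (\<lambda>x. 0)"
| "sqrt_step X (Suc n) = (\<lambda>x. (1/2) *\<^sub>R (X x + sqrt_step X n (sqrt_step X n x)))"

primrec sqrt_bound :: "nat \<Rightarrow> real" where
  "sqrt_bound 0 = 0"
| "sqrt_bound (Suc n) = (1 + (sqrt_bound n)\<^sup>2) / 2"

lemma sqrt_bound_range: "0 \<le> sqrt_bound n \<and> sqrt_bound n \<le> 1"
  by (induction n) (auto simp: power_le_one)

lemma sqrt_bound_incseq: "incseq sqrt_bound"
proof (rule incseq_SucI)
  fix n
  have "0 \<le> (1 - sqrt_bound n)\<^sup>2" by simp
  then show "sqrt_bound n \<le> sqrt_bound (Suc n)" by (simp add: power2_eq_square algebra_simps)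
qed

lemma sqrt_step_linear: "linear X \<Longrightarrow> linear (sqrt_step X n)"
proof (induction n)
  case (Suc n)
  then show ?case
    by (auto intro!: linearI simp: linear_add linear_scale algebra_simps)
qed (simp add: linear_zero)

lemma sqrt_step_sym:
  assumes "adjoint_pair X X"
  shows "adjoint_pair (sqrt_step X n) (sqrt_step X n)"
proof (induction n)
  case 0
  then show ?case by (simp add: adjoint_pair_def)
next
  case (Suc n)
  show ?case
    unfolding adjoint_pair_def sqrt_step.simps
    by (simp add: inner_add_left inner_add_right adjoint_pairD[OF assms] adjoint_pairD[OF Suc])
qed

lemma sqrt_step_commute:
  assumes "linear U" "\<And>x. X (U x) = U (X x)"
  shows "sqrt_step X n (U x) = U (sqrt_step X n x)"
proof (induction n arbitrary: x)
  case (Suc n)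
  show ?case
    by (simp only: sqrt_step.simps assms(2) Suc linear_add[OF assms(1)] linear_scale[OF assms(1)])
qed (simp add: linear_0[OF assms(1)])

lemma sqrt_step_norm:
  assumes X: "\<And>x. norm (X x) \<le> norm x"
  shows "norm (sqrt_step X n x) \<le> sqrt_bound n * norm x"
proof (induction n arbitrary: x)
  case (Suc n)
  have "norm (sqrt_step X n (sqrt_step X n x)) \<le> sqrt_bound n * (sqrt_bound n * norm x)"
    using Suc[of "sqrt_step X n x"] Suc[of x] sqrt_bound_range[of n]
    by (meson mult_left_mono order_trans)
  then have "norm (X x + sqrt_step X n (sqrt_step X n x)) \<le> (1 + (sqrt_bound n)\<^sup>2) * norm x"
    using X[of x] norm_triangle_ineq[of "X x" "sqrt_step X n (sqrt_step X n x)"]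
    by (simp add: power2_eq_square algebra_simps)
  then show ?case by simp
qed simp

text \<open>The increment of the squares splits as
  \<open>Y' Y' - Y Y = Y' (Y' - Y) + (Y' - Y) Y\<close>. The scalar iteration obeys the same
  identity, so bounding each factor by its scalar counterpart closes the induction.\<close>

lemma sqrt_step_diff:
  assumes X: "\<And>x. norm (X x) \<le> norm x" and lin: "linear X"
  shows "norm (sqrt_step X (Suc n) x - sqrt_step X n x) \<le> (sqrt_bound (Suc n) - sqrt_bound n) * norm x"
proof (induction n arbitrary: x)
  case 0
  then show ?case using X[of x] by simp
next
  case (Suc n)
  let ?Y = "sqrt_step X" and ?y = sqrt_bound
  define d where "d = ?y (Suc n) - ?y n"
  have d: "d \<ge> 0" unfolding d_def using incseq_SucD[OF sqrt_bound_incseq] by (simp del: sqrt_bound.simps)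
  note lY = sqrt_step_linear[OF lin]
  have "?Y (Suc (Suc n)) x - ?Y (Suc n) x
      = (1/2) *\<^sub>R (?Y (Suc n) (?Y (Suc n) x) - ?Y n (?Y n x))"
    by (simp only: sqrt_step.simps(2)[of X "Suc n"] sqrt_step.simps(2)[of X n] flip: scaleR_diff_right)
      simp
  also have "?Y (Suc n) (?Y (Suc n) x) - ?Y n (?Y n x)
      = ?Y (Suc n) (?Y (Suc n) x - ?Y n x) + (?Y (Suc n) (?Y n x) - ?Y n (?Y n x))"
    by (simp only: linear_diff[OF lY]) simp
  finally have eq: "?Y (Suc (Suc n)) x - ?Y (Suc n) x
      = (1/2) *\<^sub>R (?Y (Suc n) (?Y (Suc n) x - ?Y n x) + (?Y (Suc n) (?Y n x) - ?Y n (?Y n x)))" .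
  have "norm (?Y (Suc n) (?Y (Suc n) x - ?Y n x)) \<le> ?y (Suc n) * (d * norm x)"
    using sqrt_step_norm[OF X, of "Suc n" "?Y (Suc n) x - ?Y n x"] Suc[of x] sqrt_bound_range[of "Suc n"]
    unfolding d_def by (meson mult_left_mono order_trans)
  moreover have "norm (?Y (Suc n) (?Y n x) - ?Y n (?Y n x)) \<le> d * (?y n * norm x)"
    using Suc[of "?Y n x"] sqrt_step_norm[OF X, of n x] d
    unfolding d_def by (meson mult_left_mono order_trans)
  ultimately have "norm (?Y (Suc (Suc n)) x - ?Y (Suc n) x)
      \<le> (1/2) * (?y (Suc n) * (d * norm x) + d * (?y n * norm x))"
    unfolding eq norm_scaleR
    using norm_triangle_ineq[of "?Y (Suc n) (?Y (Suc n) x - ?Y n x)" "?Y (Suc n) (?Y n x) - ?Y n (?Y n x)"]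
    by simp
  also have "\<dots> = (1/2) * ((?y (Suc n))\<^sup>2 - (?y n)\<^sup>2) * norm x"
    unfolding d_def by (simp only: power2_eq_square) algebra
  also have "(1/2) * ((?y (Suc n))\<^sup>2 - (?y n)\<^sup>2) = ?y (Suc (Suc n)) - ?y (Suc n)"
    by (simp only: sqrt_bound.simps(2)[of "Suc n"] sqrt_bound.simps(2)[of n]) (simp add: field_simps)
  finally show ?case .
qed

lemma sqrt_step_diff_le:
  assumes X: "\<And>x. norm (X x) \<le> norm x" and lin: "linear X" and "n \<le> m"
  shows "norm (sqrt_step X m x - sqrt_step X n x) \<le> (sqrt_bound m - sqrt_bound n) * norm x"
  using \<open>n \<le> m\<close>
proof (induction m rule: dec_induct)
  case (step m)
  have "norm (sqrt_step X (Suc m) x - sqrt_step X n x)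
     \<le> norm (sqrt_step X (Suc m) x - sqrt_step X m x) + norm (sqrt_step X m x - sqrt_step X n x)"
    using norm_triangle_ineq[of "sqrt_step X (Suc m) x - sqrt_step X m x" "sqrt_step X m x - sqrt_step X n x"]
    by (simp del: sqrt_step.simps)
  also have "\<dots> \<le> (sqrt_bound (Suc m) - sqrt_bound n) * norm x"
    using sqrt_step_diff[OF X lin, of m x] step.IH by (simp only: left_diff_distrib)
  finally show ?case .
qed simp

text \<open>
  The iteration \<open>Y\<^bsub>n+1\<^esub> = (X + Y\<^sub>n\<^sup>2) / 2\<close> with \<open>X = 1 - S\<^sup>2\<close> converges to \<open>1 - \<bar>S\<bar>\<close>; it is
  dominated by the scalar iteration with \<open>X = 1\<close>.
\<close>
lemma abs_exists:
  fixes S :: "'a::{real_inner, complete_space} \<Rightarrow> 'a"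
  assumes S: "adjoint_pair S S" and contr: "\<And>x. norm (S x) \<le> norm x"
  obtains T where "adjoint_pair T T" "\<And>x. T (T x) = S (S x)" "\<And>x. 0 \<le> inner (T x) x"
    "\<And>U U' x. adjoint_pair U U' \<Longrightarrow> (\<And>x. S (U x) = U (S x)) \<Longrightarrow> T (U x) = U (T x)"
proof -
  define X where "X x = x - S (S x)" for x
  note linS = adjoint_pair_linear[OF S]
  have symX: "adjoint_pair X X"
    unfolding X_def adjoint_pair_def by (simp add: inner_diff_left inner_diff_right adjoint_pairD[OF S])
  note linX = adjoint_pair_linear[OF symX]
  have contrX: "norm (X x) \<le> norm x" for x
  proof -
    have "(norm (X x))\<^sup>2 = (norm x)\<^sup>2 - 2 * (norm (S x))\<^sup>2 + (norm (S (S x)))\<^sup>2"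
      unfolding X_def power2_norm_eq_inner
      by (simp add: inner_diff_left inner_diff_right inner_commute adjoint_pairD[OF S])
    moreover have "(norm (S (S x)))\<^sup>2 \<le> (norm (S x))\<^sup>2"
      using contr by (simp add: power_mono)
    ultimately have "(norm (X x))\<^sup>2 \<le> (norm x)\<^sup>2" by (smt (verit) zero_le_power2)
    then show ?thesis using norm_ge_zero by (rule power2_le_imp_le)
  qed
  define Y where "Y = sqrt_step X"
  have symY: "adjoint_pair (Y n) (Y n)" for n unfolding Y_def by (rule sqrt_step_sym[OF symX])
  have normY: "norm (Y n x) \<le> norm x" for n x
    using sqrt_step_norm[OF contrX, of n x] sqrt_bound_range[of n] unfolding Y_def
    by (metis mult_left_le_one_le norm_ge_zero order_trans)
  have "\<forall>n. sqrt_bound n \<le> 1" using sqrt_bound_range by simp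
  then obtain l where "sqrt_bound \<longlonglongrightarrow> l"
    by (rule incseq_convergent[OF sqrt_bound_incseq])
  then have "convergent sqrt_bound" by (rule convergentI)
  have "convergent (\<lambda>n. Y n x)" for x
  proof (rule convergent_of_square_bound)
    show "convergent (\<lambda>n. sqrt_bound n * (norm x)\<^sup>2)"
      using \<open>convergent sqrt_bound\<close> unfolding convergent_def by (blast intro: tendsto_mult_right)
    fix m n :: nat assume nm: "n \<le> m"
    define d where "d = sqrt_bound m - sqrt_bound n"
    have d: "0 \<le> d" "d \<le> 1"
      unfolding d_def using sqrt_bound_range[of m] sqrt_bound_range[of n]
        incseqD[OF sqrt_bound_incseq nm] by linarith+
    have "(norm (Y m x - Y n x))\<^sup>2 \<le> (d * norm x)\<^sup>2"
      unfolding Y_def d_def using sqrt_step_diff_le[OF contrX linX nm] by (simp add: power_mono)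
    \<comment> \<open>Since \<open>0 \<le> d \<le> 1\<close>, the square of \<open>d\<close> is at
      most \<open>d\<close>; this gives the linear shape that
      \<open>convergent_of_square_bound\<close> asks for.\<close>
    also have "\<dots> \<le> d * (norm x)\<^sup>2"
      unfolding power_mult_distrib power2_eq_square[of d] using d
      by (simp add: mult_left_le mult_right_mono)
    also have "\<dots> \<le> \<bar>sqrt_bound m * (norm x)\<^sup>2 - sqrt_bound n * (norm x)\<^sup>2\<bar>"
      unfolding d_def by (simp add: left_diff_distrib)
    finally show "(norm (Y m x - Y n x))\<^sup>2
      \<le> \<bar>sqrt_bound m * (norm x)\<^sup>2 - sqrt_bound n * (norm x)\<^sup>2\<bar>" .
  qed
  then obtain Z where Z: "\<And>x. (\<lambda>n. Y n x) \<longlonglongrightarrow> Z x" unfolding convergent_def by metis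
  have normZ: "norm (Z x) \<le> norm x" for x
    using LIMSEQ_le_const2[OF tendsto_norm[OF Z]] normY by blast
  have symZ: "adjoint_pair Z Z"
    unfolding adjoint_pair_def
  proof (intro allI)
    fix x y
    have "(\<lambda>n. inner (Y n x) y) \<longlonglongrightarrow> inner (Z x) y" by (intro tendsto_intros Z)
    moreover have "(\<lambda>n. inner (Y n x) y) \<longlonglongrightarrow> inner x (Z y)"
      unfolding adjoint_pairD[OF symY] by (intro tendsto_intros Z)
    ultimately show "inner (Z x) y = inner x (Z y)" using LIMSEQ_unique by blast
  qed
  have fixpoint: "2 *\<^sub>R Z x = X x + Z (Z x)" for x
  proof -
    \<comment> \<open>Both factors of \<open>Y n (Y n x)\<close> move. The uniform contraction bound
      removes the difference and leaves \<open>Y n (Z x)\<close>, a single limit.\<close>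
    have "(\<lambda>n. Y n (Y n x - Z x)) \<longlonglongrightarrow> 0"
    proof (rule Lim_null_comparison)
      show "\<forall>\<^sub>F n in sequentially. norm (Y n (Y n x - Z x)) \<le> norm (Y n x - Z x)"
        using normY by simp
      show "(\<lambda>n. norm (Y n x - Z x)) \<longlonglongrightarrow> 0"
        using Z[of x] by (metis LIM_zero tendsto_norm_zero)
    qed
    then have "(\<lambda>n. Y n (Y n x - Z x) + Y n (Z x)) \<longlonglongrightarrow> 0 + Z (Z x)"
      by (intro tendsto_add Z)
    then have "(\<lambda>n. Y n (Y n x)) \<longlonglongrightarrow> Z (Z x)"
      by (simp add: linear_diff[OF adjoint_pair_linear[OF symY]])
    then have "(\<lambda>n. Y (Suc n) x) \<longlonglongrightarrow> (1/2) *\<^sub>R (X x + Z (Z x))"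
      unfolding Y_def by (simp only: sqrt_step.simps) (intro tendsto_intros)
    moreover have "(\<lambda>n. Y (Suc n) x) \<longlonglongrightarrow> Z x" using Z LIMSEQ_Suc by blast
    ultimately have "Z x = (1/2) *\<^sub>R (X x + Z (Z x))" using LIMSEQ_unique by blast
    then have "2 *\<^sub>R Z x = 2 *\<^sub>R (1/2) *\<^sub>R (X x + Z (Z x))" by (rule arg_cong)
    then show ?thesis by simp
  qed
  define T where "T x = x - Z x" for x
  note linZ = adjoint_pair_linear[OF symZ]
  show thesis
  proof (rule that[of T])
    show "adjoint_pair T T"
      unfolding T_def adjoint_pair_def by (simp add: inner_diff_left inner_diff_right adjoint_pairD[OF symZ])
    show "T (T x) = S (S x)" for x
      unfolding T_def linear_diff[OF linZ] using fixpoint[of x]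
      by (simp add: X_def scaleR_2 algebra_simps)
    show "0 \<le> inner (T x) x" for x
    proof -
      have "inner (Z x) x \<le> norm (Z x) * norm x" by (rule norm_cauchy_schwarz)
      also have "\<dots> \<le> norm x * norm x" using normZ by (simp add: mult_right_mono)
      finally show ?thesis
        unfolding T_def by (simp add: inner_diff_left flip: power2_norm_eq_inner power2_eq_square)
    qed
    show "T (U x) = U (T x)" if U: "adjoint_pair U U'" and comm: "\<And>x. S (U x) = U (S x)" for U U' x
    proof -
      note linU = adjoint_pair_linear[OF U]
      have "X (U x) = U (X x)" for x by (simp add: X_def comm linear_diff[OF linU])
      then have "U (Y n x) = Y n (U x)" for n
        unfolding Y_def using sqrt_step_commute[OF linU] by metis
      then have "(\<lambda>n. U (Y n x)) \<longlonglongrightarrow> Z (U x)" using Z by simp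
      then have "U (Z x) = Z (U x)"
        using adjoint_pair_weak_limit[OF U Z] by (metis sequentially_bot)
      then show ?thesis by (simp add: T_def linear_diff[OF linU])
    qed
  qed
qed

text \<open>Let \<open>T\<close> be the absolute value of \<open>S\<close> and \<open>N\<close> the
  kernel of \<open>T + S\<close>. On \<open>N\<close> one has \<open>S = - T\<close>. Because
  \<open>(T + S) (T - S) = 0\<close>, the range of \<open>T - S\<close> lies in \<open>N\<close>, so
  a vector orthogonal to \<open>N\<close> is killed by \<open>T - S\<close> and satisfies
  \<open>S = T\<close> there. The kernel of \<open>S\<close> is contained in that of
  \<open>T\<close>, hence in \<open>N\<close>.\<close>

lemma sign_projection:
  fixes S :: "'a::{real_inner, complete_space} \<Rightarrow> 'a"
  assumes S: "adjoint_pair S S" and contr: "\<And>x. norm (S x) \<le> norm x"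
  obtains E where "orth_proj E" "\<And>x. E x = x \<Longrightarrow> inner (S x) x \<le> 0" "\<And>x. E x = 0 \<Longrightarrow> 0 \<le> inner (S x) x"
    "\<And>x. S x = 0 \<Longrightarrow> E x = x"
    "\<And>U U' x. adjoint_pair U U' \<Longrightarrow> (\<And>x. S (U x) = U (S x)) \<Longrightarrow> (\<And>x. S (U' x) = U' (S x))
      \<Longrightarrow> E (U x) = U (E x)"
proof -
  obtain T where T: "adjoint_pair T T" and sq: "\<And>x. T (T x) = S (S x)" and pos: "\<And>x. 0 \<le> inner (T x) x"
    and commT: "\<And>U U' x. adjoint_pair U U' \<Longrightarrow> (\<And>x. S (U x) = U (S x)) \<Longrightarrow> T (U x) = U (T x)"
    by (rule abs_exists[OF S contr]) blast
  note linS = adjoint_pair_linear[OF S] and linT = adjoint_pair_linear[OF T]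
  have TS: "T (S x) = S (T x)" for x by (rule commT[OF S]) simp
  define N where "N = {x. T x + S x = 0}"
  \<comment> \<open>Written as the annihilator of the range of \<open>T + S\<close>,
    \<open>N\<close> is visibly a closed subspace.\<close>
  have N_iff: "x \<in> N \<longleftrightarrow> (\<forall>z. inner x (T z + S z) = 0)" for x
  proof -
    have "inner x (T z + S z) = inner (T x + S x) z" for z
      by (simp add: inner_add_left inner_add_right adjoint_pairD[OF S] adjoint_pairD[OF T])
    then show ?thesis unfolding N_def by (auto dest: spec[of _ "T x + S x"])
  qed
  have "subspace N"
    unfolding subspace_def by (auto simp: N_iff inner_add_left)
  moreover have "closed N"
  proof -
    have "N = (\<Inter>z. {x. inner x (T z + S z) = 0})" using N_iff by blast
    then show ?thesis by (auto intro!: closed_INT closed_Collect_eq continuous_intros)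
  qed
  ultimately obtain E where E: "orth_proj E" "\<And>x. E x \<in> N" "\<And>x. x \<in> N \<Longrightarrow> E x = x"
    "\<And>x z. z \<in> N \<Longrightarrow> inner (x - E x) z = 0"
    using orth_proj_exists by metis
  show thesis
  proof (rule that[OF E(1)])
    fix x assume "E x = x"
    then have "x \<in> N" using E(2) by metis
    then have "S x = - T x" unfolding N_def by (simp add: eq_neg_iff_add_eq_0 add.commute)
    then show "inner (S x) x \<le> 0" using pos[of x] by simp
  next
    fix x assume "E x = 0"
    define w where "w = T x - S x"
    have inN: "T z - S z \<in> N" for z
      unfolding N_def by (simp add: linear_diff[OF linT] linear_diff[OF linS] sq TS)
    have "inner w w = inner x (T w - S w)"
      unfolding w_def
      by (simp add: inner_diff_left inner_diff_right adjoint_pairD[OF S] adjoint_pairD[OF T]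
          linear_diff[OF linT] linear_diff[OF linS])
    also have "\<dots> = 0" using E(4)[OF inN, of x w] \<open>E x = 0\<close> by simp
    finally have "T x = S x" unfolding w_def by simp
    then show "0 \<le> inner (S x) x" using pos[of x] by simp
  next
    fix x assume "S x = 0"
    then have "inner (T x) (T x) = 0" unfolding adjoint_pairD[OF T] by (simp add: sq linear_0[OF linS])
    then show "E x = x" using E(3)[of x] \<open>S x = 0\<close> unfolding N_def by simp
  next
    fix U U' x
    assume U: "adjoint_pair U U'" and comm: "\<And>x. S (U x) = U (S x)" "\<And>x. S (U' x) = U' (S x)"
    note U' = adjoint_pair_sym[OF U]
    have "U x \<in> N" if "x \<in> N" for x
      using that commT[OF U comm(1)] comm(1) unfolding N_def
      by simp (metis adjoint_pair_linear[OF U] linear_0 linear_add)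
    moreover have "U' x \<in> N" if "x \<in> N" for x
      using that commT[OF U' comm(2)] comm(2) unfolding N_def
      by simp (metis adjoint_pair_linear[OF U'] linear_0 linear_add)
    ultimately show "E (U x) = U (E x)"
      using orth_proj_commute[OF E(1) E(2) E(3) U] by blast
  qed
qed

section \<open>Unbounded self-adjoint operators\<close>

text \<open>\<open>adj_iff\<close> says that the graph of \<open>A\<close> on \<open>D\<close> is
  the graph of the adjoint. Linearity on \<open>D\<close>, symmetry and closedness are all read off
  from it by testing against vectors of \<open>D\<close>.\<close>

locale real_self_adjoint =
  fixes D :: "'a::{real_inner, complete_space} set" and A :: "'a \<Rightarrow> 'a"
  assumes dense: "closure D = UNIV"
    and adj_iff: "y \<in> D \<and> A y = z \<longleftrightarrow> (\<forall>x\<in>D. inner (A x) y = inner x z)"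
begin

lemma adjI: "(\<And>x. x \<in> D \<Longrightarrow> inner (A x) y = inner x z) \<Longrightarrow> y \<in> D \<and> A y = z"
  using adj_iff by blast

lemma sym: "x \<in> D \<Longrightarrow> y \<in> D \<Longrightarrow> inner (A x) y = inner x (A y)"
  using adj_iff by blast

lemma D_add: "x \<in> D \<Longrightarrow> y \<in> D \<Longrightarrow> x + y \<in> D \<and> A (x + y) = A x + A y"
  by (rule adjI) (simp add: inner_add_right sym)

lemma D_0: "0 \<in> D \<and> A 0 = 0"
  by (rule adjI) simp

lemma D_diff: "x \<in> D \<Longrightarrow> y \<in> D \<Longrightarrow> x - y \<in> D \<and> A (x - y) = A x - A y"
  by (rule adjI) (simp add: inner_diff_right sym)

lemma D_minus: "x \<in> D \<Longrightarrow> - x \<in> D \<and> A (- x) = - A x"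
  by (rule adjI) (simp add: sym)

lemma D_closed:
  assumes "\<And>n. u n \<in> D" "u \<longlonglongrightarrow> x" "(\<lambda>n. A (u n)) \<longlonglongrightarrow> z"
  shows "x \<in> D \<and> A x = z"
proof (rule adjI)
  fix w assume w: "w \<in> D"
  have "(\<lambda>n. inner (A w) (u n)) \<longlonglongrightarrow> inner (A w) x" by (intro tendsto_intros assms)
  moreover have "(\<lambda>n. inner (A w) (u n)) \<longlonglongrightarrow> inner w z"
    unfolding sym[OF w assms(1)] by (intro tendsto_intros assms)
  ultimately show "inner (A w) x = inner w z" using LIMSEQ_unique by blast
qed

section \<open>The bounded transforms of the operator\<close>

lemma resolvent_exists: "\<exists>v. v \<in> D \<and> A v \<in> D \<and> v + A (A v) = u"
proof -
  \<comment> \<open>The graph of \<open>A\<close>, described as that of the adjoint so that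
    closedness is evident. The pair \<open>(u, 0)\<close> is projected onto it (von Neumann's
    argument).\<close>
  define M where "M = {p :: 'a \<times> 'a. \<forall>x\<in>D. inner (A x) (fst p) = inner x (snd p)}"
  have M_iff: "p \<in> M \<longleftrightarrow> fst p \<in> D \<and> A (fst p) = snd p" for p
    unfolding M_def using adj_iff by simp
  have "subspace M"
    unfolding subspace_def M_def by (simp add: inner_add_right)
  moreover have "closed M"
  proof -
    have "M = (\<Inter>x\<in>D. {p. inner (A x) (fst p) = inner x (snd p)})" unfolding M_def by auto
    then show ?thesis by (auto intro!: closed_INT closed_Collect_eq continuous_intros)
  qed
  ultimately obtain p where p: "p \<in> M" "\<And>z. z \<in> M \<Longrightarrow> inner ((u, 0) - p) z = 0"
    using orthogonal_decomposition[of M "(u, 0)"] by metis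
  \<comment> \<open>Write \<open>p = (v, A v)\<close>. Orthogonality of
    \<open>(u - v, - A v)\<close> to all \<open>(x, A x)\<close> says
    \<open>inner (A x) (A v) = inner x (u - v)\<close>: the defining property of \<open>A v\<close>
    being in the domain of the adjoint with value \<open>u - v\<close>.\<close>
  have "- snd p \<in> D \<and> A (- snd p) = fst p - u"
  proof (rule adjI)
    fix x assume "x \<in> D"
    then have "inner ((u, 0) - p) (x, A x) = 0" using p(2) M_iff by simp
    then show "inner (A x) (- snd p) = inner x (fst p - u)"
      by (simp add: inner_prod_def inner_diff_left inner_diff_right inner_commute)
  qed
  then have "snd p \<in> D \<and> A (snd p) = u - fst p" using D_minus[of "- snd p"] by simp
  then show ?thesis using p(1) M_iff by (intro exI[of _ "fst p"]) auto
qed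

lemma resolvent_unique:
  assumes "v \<in> D" "A v \<in> D" "w \<in> D" "A w \<in> D" "v + A (A v) = w + A (A w)"
  shows "v = w"
proof -
  have d: "v - w \<in> D" "A (v - w) \<in> D" "A (v - w) = A v - A w"
    using D_diff assms by auto
  have "(v - w) + A (A (v - w)) = 0"
    using assms(5) unfolding d(3) D_diff[OF assms(2,4), THEN conjunct2] by (simp add: algebra_simps)
  then have "inner (v - w) (v - w) + inner (A (A (v - w))) (v - w) = 0"
    by (metis inner_add_left inner_zero_left)
  then have "inner (v - w) (v - w) + inner (A (v - w)) (A (v - w)) = 0"
    using sym[OF d(2,1)] by simp
  then show ?thesis
    by (metis add_nonneg_eq_0_iff eq_iff_diff_eq_0 inner_eq_zero_iff inner_ge_zero)
qed

text \<open>\<open>R = (1 + A\<^sup>2)\<^sup>-\<^sup>1\<close> and \<open>S = A R\<close>; \<open>A\<close> is recovered from them through \<open>x = R x + S (A x)\<close>.\<close>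

definition R :: "'a \<Rightarrow> 'a" where "R u = (SOME v. v \<in> D \<and> A v \<in> D \<and> v + A (A v) = u)"
definition S :: "'a \<Rightarrow> 'a" where "S u = A (R u)"

lemma R: "R u \<in> D" "S u \<in> D" "A (R u) = S u" "A (S u) = u - R u"
proof -
  have "R u \<in> D \<and> A (R u) \<in> D \<and> R u + A (A (R u)) = u"
    unfolding R_def by (rule someI_ex[OF resolvent_exists])
  then show "R u \<in> D" "S u \<in> D" "A (R u) = S u" "A (S u) = u - R u"
    unfolding S_def by (auto simp: algebra_simps)
qed

lemma R_eqI: "v \<in> D \<Longrightarrow> A v \<in> D \<Longrightarrow> v + A (A v) = u \<Longrightarrow> R u = v"
  by (rule resolvent_unique) (simp_all add: R)

text \<open>\<open>inner (R u) v\<close> equals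
  \<open>inner (R u) (R v) + inner (S u) (S v)\<close>, which is symmetric in \<open>u\<close> and
  \<open>v\<close>.\<close>

lemma R_sym: "adjoint_pair R R"
proof -
  have *: "inner (R u) v = inner (R u) (R v) + inner (S u) (S v)" for u v
  proof -
    have "inner (R u) (v - R v) = inner (S u) (S v)"
      using sym[of "R u" "S v"] R by simp
    then show ?thesis by (simp add: inner_diff_right)
  qed
  have "inner (R u) v = inner u (R v)" for u v
  proof -
    have "inner (R v) u = inner (R u) (R v) + inner (S u) (S v)"
      unfolding *[of v u] by (simp add: inner_commute)
    then show ?thesis using *[of u v] inner_commute[of u "R v"] by linarith
  qed
  then show ?thesis unfolding adjoint_pair_def by blast
qed

lemma S_sym: "adjoint_pair S S"
  unfolding adjoint_pair_def
proof (intro allI)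
  fix u v
  have "inner (S u) v = inner (S u) (R v) + inner (S u) (A (S v))"
    using R(4)[of v] by (simp add: inner_diff_right)
  also have "inner (S u) (R v) = inner (R u) (S v)" using sym[of "R u" "R v"] R by simp
  also have "inner (S u) (A (S v)) = inner (u - R u) (S v)" using sym[of "S u" "S v"] R by simp
  finally show "inner (S u) v = inner u (S v)" by (simp add: inner_diff_left)
qed

lemma S_contraction: "norm (S u) \<le> norm u"
proof -
  have "inner (R u) (u - R u) = inner (S u) (S u)"
    using sym[of "R u" "S u"] R by simp
  then have *: "(norm (S u))\<^sup>2 = inner (R u) u - (norm (R u))\<^sup>2"
    by (simp add: inner_diff_right power2_norm_eq_inner)
  moreover have "inner (R u) u \<le> norm (R u) * norm u" by (rule norm_cauchy_schwarz)
  moreover have "2 * (norm (R u) * norm u) \<le> (norm (R u))\<^sup>2 + (norm u)\<^sup>2"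
    using sum_squares_bound[of "norm (R u)" "norm u"] by (simp add: mult.assoc)
  ultimately have "(norm (S u))\<^sup>2 \<le> (norm u)\<^sup>2"
    using zero_le_power2[of "norm u"] zero_le_power2[of "norm (R u)"] by linarith
  then show ?thesis using norm_ge_zero by (rule power2_le_imp_le)
qed

lemma R_A: "x \<in> D \<Longrightarrow> R (A x) = S x"
  by (rule R_eqI) (simp_all add: R D_diff)

lemma S_A: "x \<in> D \<Longrightarrow> S (A x) = x - R x"
  using R(3)[of "A x"] R_A R(4) by simp

section \<open>Commutant and bicommutant\<close>

definition comm :: "('a \<Rightarrow> 'a) \<Rightarrow> bool" where
  "comm U \<longleftrightarrow> (\<forall>x\<in>D. U x \<in> D \<and> A (U x) = U (A x))"

text \<open>This property is preserved by sums, products and strong limits, so it can be carried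
  through every construction. It makes any two of the projections commute with each other and,
  because \<open>R\<close> and \<open>S\<close> are admissible choices of \<open>U\<close>, with
  \<open>A\<close>.\<close>

definition bicomm :: "('a \<Rightarrow> 'a) \<Rightarrow> bool" where
  "bicomm Q \<longleftrightarrow> (\<forall>U U'. adjoint_pair U U' \<longrightarrow> comm U \<longrightarrow> comm U' \<longrightarrow> (\<forall>x. Q (U x) = U (Q x)))"

lemma commD: "comm U \<Longrightarrow> x \<in> D \<Longrightarrow> U x \<in> D" "comm U \<Longrightarrow> x \<in> D \<Longrightarrow> A (U x) = U (A x)"
  unfolding comm_def by auto

lemma bicommD: "bicomm Q \<Longrightarrow> adjoint_pair U U' \<Longrightarrow> comm U \<Longrightarrow> comm U' \<Longrightarrow> Q (U x) = U (Q x)"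
  unfolding bicomm_def by blast

lemma comm_R: "comm R" and comm_S: "comm S"
  unfolding comm_def using R R_A S_A by auto

lemma comm_imp_R:
  assumes "linear U" "comm U"
  shows "R (U x) = U (R x)" "S (U x) = U (S x)"
proof -
  show *: "R (U x) = U (R x)" for x
    by (rule R_eqI) (simp_all add: R commD[OF assms(2)] flip: linear_add[OF assms(1)])
  show "S (U x) = U (S x)"
    using R(1)[of x] R(3)[of "U x"] R(3)[of x] * commD[OF assms(2)] by simp
qed

text \<open>The hypothesis concerns everywhere defined operators only. It yields commutation with
  \<open>R\<close> and \<open>S\<close>, and \<open>x = R x + S (A x)\<close> turns into
  \<open>Q x = R (Q x) + S (Q (A x))\<close>, which exhibits \<open>Q x\<close> as an element of
  \<open>D\<close> and lets \<open>A\<close> be applied termwise.\<close>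

lemma bicomm_imp_comm:
  assumes "linear Q" "bicomm Q"
  shows "comm Q"
  unfolding comm_def
proof
  fix x assume x: "x \<in> D"
  have QR: "Q (R y) = R (Q y)" and QS: "Q (S y) = S (Q y)" for y
    by (rule bicommD[OF assms(2) R_sym comm_R comm_R], rule bicommD[OF assms(2) S_sym comm_S comm_S])
  have "x = R x + S (A x)" using S_A[OF x] by simp
  then have eq: "Q x = R (Q x) + S (Q (A x))"
    using linear_add[OF assms(1), of "R x" "S (A x)"] QR QS by simp
  have "R (Q (A x)) = S (Q x)" using QR QS R_A[OF x] by metis
  then show "Q x \<in> D \<and> A (Q x) = Q (A x)"
    using D_add[of "R (Q x)" "S (Q (A x))"] R eq by auto
qed

lemma bicomm_diff:
  assumes "bicomm P" "bicomm Q"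
  shows "bicomm (\<lambda>x. P x - Q x)"
  unfolding bicomm_def
  by (auto simp: bicommD[OF assms(1)] bicommD[OF assms(2)] linear_diff[OF adjoint_pair_linear])

lemma bicomm_add:
  assumes "bicomm P" "bicomm Q"
  shows "bicomm (\<lambda>x. P x + Q x)"
  unfolding bicomm_def
  by (auto simp: bicommD[OF assms(1)] bicommD[OF assms(2)] linear_add[OF adjoint_pair_linear])

lemma bicomm_0: "bicomm (\<lambda>x. 0)" and bicomm_id: "bicomm (\<lambda>x. x)"
  unfolding bicomm_def by (auto dest: adjoint_pair_linear simp: linear_0)

lemma bicomm_comp: "bicomm P \<Longrightarrow> bicomm Q \<Longrightarrow> bicomm (\<lambda>x. P (Q x))"
  unfolding bicomm_def by metis

lemma bicomm_limit:
  assumes "\<And>n. bicomm (P n)" and lim: "\<And>x. (\<lambda>n. P n x) \<longlonglongrightarrow> Q x"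
  shows "bicomm Q"
  unfolding bicomm_def
proof (intro allI impI)
  fix U U' x assume U: "adjoint_pair U U'" "comm U" "comm U'"
  have "(\<lambda>n. U (P n x)) \<longlonglongrightarrow> Q (U x)"
    using lim[of "U x"] bicommD[OF assms(1) U] by simp
  then show "Q (U x) = U (Q x)"
    using adjoint_pair_weak_limit[OF U(1) lim] by (metis sequentially_bot)
qed

lemma orth_proj_comm: "orth_proj Q \<Longrightarrow> bicomm Q \<Longrightarrow> comm Q"
  using bicomm_imp_comm orth_proj_linear by blast

lemma bicomm_commute:
  "orth_proj P \<Longrightarrow> bicomm P \<Longrightarrow> orth_proj Q \<Longrightarrow> bicomm Q \<Longrightarrow> P (Q x) = Q (P x)"
  using bicommD orth_proj_adj orth_proj_comm by blast

text \<open>From \<open>A = S + A S A\<close> on forms,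
  \<open>inner (A x) x = inner (S x) x + inner (S (A x)) (A x)\<close>. As \<open>E\<close> commutes
  with \<open>A\<close>, both summands have the sign of \<open>S\<close> on the range and on the
  kernel of \<open>E\<close>.\<close>

lemma sign_projection_exists:
  obtains E where "orth_proj E" "bicomm E"
    "\<And>x. x \<in> D \<Longrightarrow> E x = x \<Longrightarrow> inner (A x) x \<le> 0"
    "\<And>x. x \<in> D \<Longrightarrow> E x = 0 \<Longrightarrow> 0 \<le> inner (A x) x"
    "\<And>x. x \<in> D \<Longrightarrow> A x = 0 \<Longrightarrow> E x = x"
proof -
  obtain E where E: "orth_proj E" "\<And>x. E x = x \<Longrightarrow> inner (S x) x \<le> 0" "\<And>x. E x = 0 \<Longrightarrow> 0 \<le> inner (S x) x"
    "\<And>x. S x = 0 \<Longrightarrow> E x = x"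
    "\<And>U U' x. adjoint_pair U U' \<Longrightarrow> (\<And>x. S (U x) = U (S x)) \<Longrightarrow> (\<And>x. S (U' x) = U' (S x))
      \<Longrightarrow> E (U x) = U (E x)"
    by (rule sign_projection[OF S_sym S_contraction]) blast
  have bi: "bicomm E"
    unfolding bicomm_def
    by (intro allI impI E(5))
      (assumption, auto intro: comm_imp_R(2) adjoint_pair_linear adjoint_pair_sym)
  have comm: "A (E x) = E (A x)" if "x \<in> D" for x
    using commD(2)[OF orth_proj_comm[OF E(1) bi] that] .
  have form: "inner (A x) x = inner (S x) x + inner (S (A x)) (A x)" if x: "x \<in> D" for x
  proof -
    have "inner (A x) x = inner (A x) (R x) + inner (A x) (x - R x)"
      by (simp add: inner_diff_right)
    also have "inner (A x) (R x) = inner (S x) x"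
      using sym[OF x R(1)[of x]] R(3)[of x] by (simp add: inner_commute)
    finally show ?thesis using S_A[OF x] by (simp add: inner_commute)
  qed
  show thesis
  proof (rule that[OF E(1) bi])
    fix x assume x: "x \<in> D"
    show "inner (A x) x \<le> 0" if "E x = x"
      using form[OF x] E(2)[OF that] E(2)[of "A x"] comm[OF x] that by simp
    show "0 \<le> inner (A x) x" if "E x = 0"
      using form[OF x] E(3)[OF that] E(3)[of "A x"] comm[OF x] that D_0 by simp
    show "E x = x" if "A x = 0"
      using R_A[OF x] that linear_0[OF adjoint_pair_linear[OF R_sym]] E(4)[of x] by simp
  qed
qed

section \<open>Shifts and the spectral family\<close>

lemma shift: "real_self_adjoint D (\<lambda>x. A x - c *\<^sub>R x)"
proof
  fix y z
  have "y \<in> D \<and> A y - c *\<^sub>R y = z \<longleftrightarrow> y \<in> D \<and> A y = z + c *\<^sub>R y" by auto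
  also have "\<dots> \<longleftrightarrow> (\<forall>x\<in>D. inner (A x) y = inner x (z + c *\<^sub>R y))" by (rule adj_iff)
  also have "\<dots> \<longleftrightarrow> (\<forall>x\<in>D. inner (A x - c *\<^sub>R x) y = inner x z)"
    by (intro ball_cong refl) (auto simp: inner_add_right inner_diff_left)
  finally show "y \<in> D \<and> A y - c *\<^sub>R y = z \<longleftrightarrow> (\<forall>x\<in>D. inner (A x - c *\<^sub>R x) y = inner x z)" .
qed (rule dense)

text \<open>All shifts have the same commutant, so the projections built from different
  \<open>c\<close> belong to one bicommutant.\<close>

lemma shift_comm:
  assumes "linear U"
  shows "real_self_adjoint.comm D (\<lambda>x. A x - c *\<^sub>R x) U \<longleftrightarrow> comm U"
proof -
  interpret B: real_self_adjoint D "\<lambda>x. A x - c *\<^sub>R x" by (rule shift)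
  show ?thesis
    unfolding comm_def B.comm_def by (auto simp: linear_diff[OF assms] linear_scale[OF assms])
qed

text \<open>The form bounds leave the kernel of \<open>A - c\<close> undecided; the last clause puts
  it into the range of \<open>E\<close>.\<close>

definition spectral_at :: "real \<Rightarrow> ('a \<Rightarrow> 'a) \<Rightarrow> bool" where
  "spectral_at c E \<longleftrightarrow> orth_proj E \<and> bicomm E \<and>
     (\<forall>x\<in>D. E x = x \<longrightarrow> inner (A x) x \<le> c * inner x x) \<and>
     (\<forall>x\<in>D. E x = 0 \<longrightarrow> c * inner x x \<le> inner (A x) x) \<and>
     (\<forall>x\<in>D. A x = c *\<^sub>R x \<longrightarrow> E x = x)"

definition spectral_family :: "real \<Rightarrow> 'a \<Rightarrow> 'a" where
  "spectral_family c = (SOME E. spectral_at c E)"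

lemma spectral_family: "spectral_at c (spectral_family c)"
proof -
  interpret B: real_self_adjoint D "\<lambda>x. A x - c *\<^sub>R x" by (rule shift)
  obtain E where E: "orth_proj E" "B.bicomm E"
    "\<And>x. x \<in> D \<Longrightarrow> E x = x \<Longrightarrow> inner (A x - c *\<^sub>R x) x \<le> 0"
    "\<And>x. x \<in> D \<Longrightarrow> E x = 0 \<Longrightarrow> 0 \<le> inner (A x - c *\<^sub>R x) x"
    "\<And>x. x \<in> D \<Longrightarrow> A x - c *\<^sub>R x = 0 \<Longrightarrow> E x = x"
    by (rule B.sign_projection_exists) blast
  have "bicomm E"
    unfolding bicomm_def
  proof (intro allI impI)
    fix U U' x assume U: "adjoint_pair U U'" "comm U" "comm U'"
    then show "E (U x) = U (E x)"
      using B.bicommD[OF E(2) U(1)] shift_comm[OF adjoint_pair_linear[OF U(1)]]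
        shift_comm[OF adjoint_pair_linear[OF adjoint_pair_sym[OF U(1)]]] by simp
  qed
  then have "spectral_at c E"
    unfolding spectral_at_def using E by (simp add: inner_diff_left)
  then show ?thesis unfolding spectral_family_def by (rule someI[of "spectral_at c"])
qed

section \<open>Form bounds on reducing subspaces\<close>

lemma range_dense:
  assumes "orth_proj Q" "comm Q" "Q x = x"
  obtains u where "\<And>n::nat. u n \<in> D" "\<And>n. Q (u n) = u n" "u \<longlonglongrightarrow> x"
proof -
  obtain w where w: "\<And>n. w n \<in> D" "w \<longlonglongrightarrow> x"
    using dense closure_sequential[of x D] by auto
  then have "(\<lambda>n. Q (w n)) \<longlonglongrightarrow> x" using orth_proj_tendsto[OF assms(1) w(2)] assms(3) by simp
  then show thesis
    using that[of "\<lambda>n. Q (w n)"] w(1) commD(1)[OF assms(2)] orth_proj_idem[OF assms(1)] by blast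
qed

text \<open>Forms of \<open>A\<close> make sense on \<open>D\<close> only. Since \<open>Q\<close>
  maps \<open>D\<close> into itself, vectors of \<open>D\<close> are dense in the range of
  \<open>Q\<close>, and vanishing may be tested there. The order and limit statements about
  \<open>E\<close> are reduced to this.\<close>

lemma range_zero:
  assumes "orth_proj Q" "comm Q" "\<And>x. x \<in> D \<Longrightarrow> Q x = x \<Longrightarrow> x = 0"
  shows "Q x = 0"
proof -
  obtain u where u: "\<And>n::nat. u n \<in> D" "\<And>n. Q (u n) = u n" "u \<longlonglongrightarrow> Q x"
    using range_dense[OF assms(1,2) orth_proj_idem[OF assms(1)]] by metis
  then have "u = (\<lambda>n. 0)" using assms(3) by blast
  then show ?thesis using u(3) LIMSEQ_unique tendsto_const by metis
qed

text \<open>A symmetric operator is bounded in norm by its form. Polarisation bounds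
  \<open>inner (A x - c *\<^sub>R x) y\<close> for \<open>y\<close> in \<open>D\<close>. The choice
  of \<open>y\<close> that gives the norm is a multiple of \<open>A x - c *\<^sub>R x\<close>, which
  may leave \<open>D\<close>, so the inequality is first extended by density to the range of
  \<open>Q\<close>.\<close>

lemma form_bound_on_domain:
  assumes Q: "orth_proj Q" "comm Q" and d: "0 \<le> d"
    and bound: "\<And>x. x \<in> D \<Longrightarrow> Q x = x \<Longrightarrow> \<bar>inner (A x - c *\<^sub>R x) x\<bar> \<le> d * inner x x"
    and x: "x \<in> D" "Q x = x"
  shows "norm (A x - c *\<^sub>R x) \<le> d * norm x"
proof -
  note linQ = orth_proj_linear[OF Q(1)]
  let ?b = "A x - c *\<^sub>R x"
  have ineq: "2 * inner ?b y \<le> d * (inner x x + inner y y)" if y: "y \<in> D" "Q y = y" for y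
  proof -
    have "x + y \<in> D" "Q (x + y) = x + y" "x - y \<in> D" "Q (x - y) = x - y"
      using D_add D_diff x y linear_add[OF linQ] linear_diff[OF linQ] by auto
    note b = bound[OF this(1,2)] bound[OF this(3,4)]
    have "inner (A y) x = inner (A x) y" using sym[OF y(1) x(1)] by (simp add: inner_commute)
    then have "inner (A (x + y) - c *\<^sub>R (x + y)) (x + y) - inner (A (x - y) - c *\<^sub>R (x - y)) (x - y)
        = 4 * inner ?b y"
      unfolding D_add[OF x(1) y(1), THEN conjunct2] D_diff[OF x(1) y(1), THEN conjunct2]
      by (simp add: inner_add_left inner_add_right inner_diff_left inner_diff_right inner_commute
          algebra_simps)
    moreover have "inner (x + y) (x + y) + inner (x - y) (x - y) = 2 * (inner x x + inner y y)"
      by (simp add: inner_add_left inner_add_right inner_diff_left inner_diff_right inner_commute)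
    then have "d * inner (x + y) (x + y) + d * inner (x - y) (x - y) = 2 * (d * (inner x x + inner y y))"
      by (metis distrib_left mult.left_commute)
    ultimately show ?thesis using b by linarith
  qed
  have ineq': "2 * inner ?b y \<le> d * (inner x x + inner y y)" if y: "Q y = y" for y
  proof -
    obtain u where u: "\<And>n::nat. u n \<in> D" "\<And>n. Q (u n) = u n" "u \<longlonglongrightarrow> y"
      using range_dense[OF Q y] by metis
    have "(\<lambda>n. 2 * inner ?b (u n)) \<longlonglongrightarrow> 2 * inner ?b y" by (intro tendsto_intros u)
    moreover have "(\<lambda>n. d * (inner x x + inner (u n) (u n))) \<longlonglongrightarrow> d * (inner x x + inner y y)"
      by (intro tendsto_intros u)
    ultimately show ?thesis by (rule LIMSEQ_le) (use ineq u in auto)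
  qed
  have Qb: "Q ?b = ?b"
    using commD(2)[OF Q(2) x(1)] x(2) by (simp add: linear_diff[OF linQ] linear_scale[OF linQ])
  \<comment> \<open>The case \<open>d = 0\<close> does occur: right continuity of \<open>E\<close>
    uses it to turn a vanishing form into an eigenvector equation.\<close>
  show ?thesis
  proof (cases "d = 0")
    case True
    then show ?thesis using ineq'[OF Qb] by (simp flip: power2_norm_eq_inner)
  next
    case False
    \<comment> \<open>\<open>y = ?b / d\<close> maximises
      \<open>2 * inner ?b y - d * inner y y\<close>.\<close>
    have "Q ((1/d) *\<^sub>R ?b) = (1/d) *\<^sub>R ?b" using Qb by (simp only: linear_scale[OF linQ])
    from ineq'[OF this] have "2 * inner ?b ?b / d \<le> d * inner x x + inner ?b ?b / d"
      using False by (simp only: inner_scaleR_left inner_scaleR_right distrib_left) simp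
    then have "inner ?b ?b \<le> d * d * inner x x" using False d by (simp add: field_simps)
    then have "(norm ?b)\<^sup>2 \<le> (d * norm x)\<^sup>2"
      unfolding power_mult_distrib power2_norm_eq_inner power2_eq_square[of d] .
    then show ?thesis by (rule power2_le_imp_le) (use d in simp)
  qed
qed

text \<open>The bound makes the images of approximating vectors Cauchy, and closedness of
  \<open>A\<close> then places the entire range of \<open>Q\<close> in \<open>D\<close>.\<close>

lemma form_bound:
  assumes Q: "orth_proj Q" "comm Q" and d: "0 \<le> d"
    and bound: "\<And>x. x \<in> D \<Longrightarrow> Q x = x \<Longrightarrow> \<bar>inner (A x - c *\<^sub>R x) x\<bar> \<le> d * inner x x"
    and x: "Q x = x"
  shows "x \<in> D" "norm (A x - c *\<^sub>R x) \<le> d * norm x"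
proof -
  note linQ = orth_proj_linear[OF Q(1)]
  obtain u where u: "\<And>n::nat. u n \<in> D" "\<And>n. Q (u n) = u n" "u \<longlonglongrightarrow> x"
    using range_dense[OF Q x] by metis
  let ?b = "\<lambda>n. A (u n) - c *\<^sub>R u n"
  have lip: "norm (?b m - ?b n) \<le> d * norm (u m - u n)" for m n
  proof -
    have eq: "?b m - ?b n = A (u m - u n) - c *\<^sub>R (u m - u n)"
      unfolding D_diff[OF u(1) u(1), THEN conjunct2] by (simp add: algebra_simps)
    show ?thesis
      unfolding eq using form_bound_on_domain[OF Q d bound, of "u m - u n"] D_diff[OF u(1) u(1)] u(2)
      by (simp add: linear_diff[OF linQ])
  qed
  have "Cauchy ?b"
  proof (rule CauchyI)
    fix e :: real assume e: "e > 0"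
    have "Cauchy u" using u(3) convergent_Cauchy convergentI by blast
    \<comment> \<open>\<open>d + 1\<close> instead of \<open>d\<close>, because \<open>d\<close> may
      be zero.\<close>
    then obtain N where N: "\<And>m n. m \<ge> N \<Longrightarrow> n \<ge> N \<Longrightarrow> norm (u m - u n) < e / (d + 1)"
      using CauchyD[of u "e / (d + 1)"] d e by auto
    have "norm (?b m - ?b n) < e" if "m \<ge> N" "n \<ge> N" for m n
    proof -
      have "norm (?b m - ?b n) \<le> (d + 1) * norm (u m - u n)"
        by (rule order_trans[OF lip]) (simp add: distrib_right)
      also have "\<dots> < e" using N[OF that] d by (simp add: field_simps)
      finally show ?thesis .
    qed
    then show "\<exists>N. \<forall>m\<ge>N. \<forall>n\<ge>N. norm (?b m - ?b n) < e" by blast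
  qed
  then obtain b where b: "?b \<longlonglongrightarrow> b" using Cauchy_convergent convergent_def by blast
  have "(\<lambda>n. ?b n + c *\<^sub>R u n) \<longlonglongrightarrow> b + c *\<^sub>R x" by (intro tendsto_intros b u)
  then have "x \<in> D \<and> A x = b + c *\<^sub>R x" using D_closed[of u x] u by simp
  then show "x \<in> D" by simp
  then show "norm (A x - c *\<^sub>R x) \<le> d * norm x"
    using form_bound_on_domain[OF Q d bound _ x] by simp
qed

end

section \<open>The spectral family and its projection-valued measure\<close>

context real_self_adjoint
begin

abbreviation E :: "real \<Rightarrow> 'a \<Rightarrow> 'a" where "E \<equiv> spectral_family"

section \<open>Order and limits of the spectral family\<close>

lemma E_proj: "orth_proj (E c)" and E_bicomm: "bicomm (E c)"
  and E_upper: "x \<in> D \<Longrightarrow> E c x = x \<Longrightarrow> inner (A x) x \<le> c * inner x x"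
  and E_lower: "x \<in> D \<Longrightarrow> E c x = 0 \<Longrightarrow> c * inner x x \<le> inner (A x) x"
  and E_eigen: "x \<in> D \<Longrightarrow> A x = c *\<^sub>R x \<Longrightarrow> E c x = x"
  using spectral_family[of c] unfolding spectral_at_def by blast+

lemma E_commute: "E a (E b x) = E b (E a x)"
  by (rule bicomm_commute[OF E_proj E_bicomm E_proj E_bicomm])

text \<open>On the range of \<open>E a - E b E a\<close> the form of \<open>A\<close> is at most
  \<open>a\<close> and at least \<open>b\<close> times the squared norm, which for
  \<open>a < b\<close> leaves only zero.\<close>

lemma E_mono:
  assumes "a \<le> b"
  shows "E b (E a x) = E a x"
proof (cases "a = b")
  case False
  note lin = orth_proj_linear[OF E_proj]
  define Q where "Q x = E a x - E b (E a x)" for x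
  have proj: "orth_proj Q"
    unfolding Q_def using orth_proj_comp[OF orth_proj_compl[OF E_proj[of b]] E_proj[of a]]
    by (simp add: linear_diff[OF lin] E_commute)
  have bi: "bicomm Q"
    unfolding Q_def by (rule bicomm_diff[OF E_bicomm bicomm_comp[OF E_bicomm E_bicomm]])
  have "Q x = 0" for x
  proof (rule range_zero[OF proj orth_proj_comm[OF proj bi]])
    fix x assume x: "x \<in> D" "Q x = x"
    have "E a (Q x) = Q x" "E b (Q x) = 0"
      unfolding Q_def
      by (simp_all add: linear_diff[OF lin] orth_proj_idem[OF E_proj] E_commute[of a b])
    then have "b * inner x x \<le> a * inner x x"
      using E_upper[OF x(1), of a] E_lower[OF x(1), of b] x(2) by simp
    then show "x = 0" using False assms
      by (metis inner_eq_zero_iff inner_ge_zero less_eq_real_def mult_strict_right_mono not_le)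
  qed
  then show ?thesis unfolding Q_def by (metis eq_iff_diff_eq_0)
qed (simp add: orth_proj_idem[OF E_proj])

lemma E_mono': "a \<le> b \<Longrightarrow> E a (E b x) = E a x"
  using E_mono E_commute by metis

lemma E_decseq_limit:
  assumes "decseq c"
  obtains Q where "orth_proj Q" "bicomm Q" "\<And>x. (\<lambda>n. E (c n) x) \<longlonglongrightarrow> Q x"
    "\<And>n x. E (c n) (Q x) = Q x"
proof -
  note lin = orth_proj_linear[OF E_proj]
  have "orth_proj (\<lambda>x. x - E (c n) x)" for n by (rule orth_proj_compl[OF E_proj])
  moreover have "(x - E (c n) x) - E (c m) (x - E (c n) x) = x - E (c n) x" if "n \<le> m" for m n x
    using E_mono'[OF decseqD[OF assms that]] by (simp add: linear_diff[OF lin])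
  ultimately obtain Q' where Q': "orth_proj Q'" "\<And>x. (\<lambda>n. x - E (c n) x) \<longlonglongrightarrow> Q' x"
    using orth_proj_increasing_limit[of "\<lambda>n x. x - E (c n) x"] by blast
  define Q where "Q x = x - Q' x" for x
  have lim: "(\<lambda>n. E (c n) x) \<longlonglongrightarrow> Q x" for x
    using tendsto_diff[OF tendsto_const Q'(2), of x x] unfolding Q_def by simp
  show thesis
  proof (rule that[OF _ _ lim])
    show "orth_proj Q" unfolding Q_def by (rule orth_proj_compl[OF Q'(1)])
    show "bicomm Q" by (rule bicomm_limit[OF E_bicomm lim])
    show "E (c n) (Q x) = Q x" for n x
    proof (rule LIMSEQ_unique)
      show "(\<lambda>m. E (c n) (E (c m) x)) \<longlonglongrightarrow> E (c n) (Q x)"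
        by (rule orth_proj_tendsto[OF E_proj lim])
      have "\<forall>\<^sub>F m in sequentially. E (c m) x = E (c n) (E (c m) x)"
        using E_mono[OF decseqD[OF assms]] by (intro eventually_sequentiallyI[of n]) simp
      then show "(\<lambda>m. E (c n) (E (c m) x)) \<longlonglongrightarrow> Q x"
        by (rule Lim_transform_eventually[OF lim])
    qed
  qed
qed

text \<open>A vector of \<open>D\<close> in the range of the limit satisfies
  \<open>inner (A x) x \<le> - n * inner x x\<close> for every \<open>n\<close>, so it is zero. The
  limit at the other end is treated alike, on the complement.\<close>

lemma E_at_bot: "(\<lambda>n. E (- real n) x) \<longlonglongrightarrow> 0"
proof -
  have "decseq (\<lambda>n. - real n)" by (simp add: decseq_def)
  then obtain Q where Q: "orth_proj Q" "bicomm Q" "\<And>x. (\<lambda>n. E (- real n) x) \<longlonglongrightarrow> Q x"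
    "\<And>n x. E (- real n) (Q x) = Q x"
    by (rule E_decseq_limit) blast
  have "Q x = 0"
  proof (rule range_zero[OF Q(1) orth_proj_comm[OF Q(1,2)]])
    fix x assume x: "x \<in> D" "Q x = x"
    have le: "real n * inner x x \<le> - inner (A x) x" for n
      using E_upper[OF x(1), of "- real n"] Q(4)[of n x] x(2) by simp
    show "x = 0"
    proof (rule ccontr)
      assume "x \<noteq> 0"
      then obtain n where "real n * inner x x > - inner (A x) x"
        using reals_Archimedean3[of "inner x x"] by auto
      then show False using le[of n] by simp
    qed
  qed
  then show ?thesis using Q(3)[of x] by simp
qed

lemma E_at_top: "(\<lambda>n. E (real n) x) \<longlonglongrightarrow> x"
proof -
  have "E (real m) (E (real n) x) = E (real n) x" if "n \<le> m" for m n x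
    using E_mono that by simp
  then obtain Q where Q: "orth_proj Q" "\<And>x. (\<lambda>n. E (real n) x) \<longlonglongrightarrow> Q x"
    using orth_proj_increasing_limit[of "\<lambda>n. E (real n)", OF E_proj] by blast
  have bi: "bicomm Q" by (rule bicomm_limit[OF E_bicomm Q(2)])
  have QE: "Q (E (real n) x) = E (real n) x" for n x
  proof (rule LIMSEQ_unique[OF Q(2)])
    have "\<forall>\<^sub>F m in sequentially. E (real n) x = E (real m) (E (real n) x)"
      using E_mono by (intro eventually_sequentiallyI[of n]) simp
    then show "(\<lambda>m. E (real m) (E (real n) x)) \<longlonglongrightarrow> E (real n) x"
      by (rule Lim_transform_eventually[OF tendsto_const])
  qed
  have proj: "orth_proj (\<lambda>x. x - Q x)" by (rule orth_proj_compl[OF Q(1)])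
  have "x - Q x = 0"
  proof (rule range_zero[OF proj orth_proj_comm[OF proj]])
    show "bicomm (\<lambda>x. x - Q x)" by (rule bicomm_diff[OF bicomm_id bi])
    fix x assume x: "x \<in> D" "x - Q x = x"
    have "E (real n) x = 0" for n
      using QE[of n x] bicomm_commute[OF E_proj E_bicomm Q(1) bi, of "real n" x] x(2)
      by (simp add: linear_0[OF orth_proj_linear[OF E_proj]])
    then have le: "real n * inner x x \<le> inner (A x) x" for n
      using E_lower[OF x(1)] by simp
    show "x = 0"
    proof (rule ccontr)
      assume "x \<noteq> 0"
      then obtain n where "real n * inner x x > inner (A x) x"
        using reals_Archimedean3[of "inner x x"] by auto
      then show False using le[of n] by simp
    qed
  qed
  then show ?thesis using Q(2)[of x] by simp
qed

text \<open>On the range of the jump \<open>P\<close> the form of \<open>A - a\<close> is bounded by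
  zero from both sides, hence \<open>A x = a *\<^sub>R x\<close> there. Such eigenvectors belong to
  the range of \<open>E a\<close>, to which the jump is orthogonal.\<close>

lemma E_right_continuous: "(\<lambda>n. E (a + inverse (real (Suc n))) x) \<longlonglongrightarrow> E a x"
proof -
  define c where "c n = a + inverse (real (Suc n))" for n
  have c_ge: "a \<le> c n" for n unfolding c_def by simp
  have c_lim: "c \<longlonglongrightarrow> a"
    unfolding c_def using LIMSEQ_inverse_real_of_nat_add by blast
  have "decseq c" unfolding c_def decseq_def by (simp add: le_imp_inverse_le)
  then obtain Q where Q: "orth_proj Q" "bicomm Q" "\<And>x. (\<lambda>n. E (c n) x) \<longlonglongrightarrow> Q x"
    "\<And>n x. E (c n) (Q x) = Q x"
    by (rule E_decseq_limit) blast
  have QE: "Q (E a x) = E a x" for x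
    using Q(3)[of "E a x"] by (simp add: E_mono[OF c_ge] LIMSEQ_const_iff)
  have EQ: "E a (Q x) = E a x" for x
    using bicomm_commute[OF E_proj E_bicomm Q(1,2)] QE by metis
  define P where "P x = Q x - E a x" for x
  have proj: "orth_proj P" unfolding P_def by (rule orth_proj_minus[OF Q(1) E_proj QE])
  have bi: "bicomm P" unfolding P_def by (rule bicomm_diff[OF Q(2) E_bicomm])
  have P_fix: "E a x = 0" "Q x = x" if "P x = x" for x
  proof -
    have "E a (P x) = 0"
      unfolding P_def by (simp add: linear_diff[OF orth_proj_linear[OF E_proj]] EQ orth_proj_idem[OF E_proj])
    then show "E a x = 0" using that by simp
    then show "Q x = x" using that unfolding P_def by simp
  qed
  have zero: "\<bar>inner (A x - a *\<^sub>R x) x\<bar> \<le> 0 * inner x x" if x: "x \<in> D" "P x = x" for x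
  proof -
    have "inner (A x) x \<le> c n * inner x x" for n
      using E_upper[OF x(1), of "c n"] Q(4)[of n x] P_fix(2)[OF x(2)] by simp
    moreover have "(\<lambda>n. c n * inner x x) \<longlonglongrightarrow> a * inner x x" by (intro tendsto_intros c_lim)
    ultimately have "inner (A x) x \<le> a * inner x x" by (intro LIMSEQ_le_const) auto
    moreover have "a * inner x x \<le> inner (A x) x"
      using E_lower[OF x(1) P_fix(1)[OF x(2)]] .
    ultimately show ?thesis by (simp add: inner_diff_left)
  qed
  have "P x = 0"
  proof (rule range_zero[OF proj orth_proj_comm[OF proj bi]])
    fix x assume x: "x \<in> D" "P x = x"
    have "norm (A x - a *\<^sub>R x) \<le> 0 * norm x"
      by (rule form_bound(2)[OF proj orth_proj_comm[OF proj bi] order_refl zero x(2)])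
    then have "E a x = x" using E_eigen[OF x(1)] by simp
    then show "x = 0" using P_fix(1)[OF x(2)] by simp
  qed
  then show ?thesis using Q(3)[of x] unfolding P_def c_def by simp
qed

section \<open>The scalar measures\<close>

definition mu :: "'a \<Rightarrow> real measure" where
  "mu x = interval_measure (\<lambda>t. inner (E t x) x)"

lemma E_form_mono:
  assumes "a \<le> b"
  shows "inner (E a x) x \<le> inner (E b x) x"
proof -
  have "norm (E a x) \<le> norm (E b x)"
    using orth_proj_norm_le[OF E_proj, of a "E b x"] E_mono'[OF assms] by simp
  then show ?thesis unfolding orth_proj_inner_self[OF E_proj] by (simp add: power_mono)
qed

lemma E_form_continuous: "continuous (at_right a) (\<lambda>t. inner (E t x) x)"
proof (subst continuous_at_right_real_increasing)
  show "\<And>s t. s \<le> t \<Longrightarrow> inner (E s x) x \<le> inner (E t x) x" by (rule E_form_mono)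
  have "(\<lambda>n. inner (E (a + inverse (real (Suc n))) x) x) \<longlonglongrightarrow> inner (E a x) x"
    by (intro tendsto_intros E_right_continuous)
  show "\<forall>e>0. \<exists>d>0. inner (E (a + d) x) x - inner (E a x) x < e"
  proof (intro allI impI)
    fix e :: real assume e: "e > 0"
    then have "\<forall>\<^sub>F n in sequentially. inner (E (a + inverse (real (Suc n))) x) x < inner (E a x) x + e"
      using order_tendstoD(2)[OF \<open>_ \<longlonglongrightarrow> inner (E a x) x\<close>] by simp
    then obtain n where "inner (E (a + inverse (real (Suc n))) x) x < inner (E a x) x + e"
      using eventually_happens'[OF sequentially_bot] by blast
    then show "\<exists>d>0. inner (E (a + d) x) x - inner (E a x) x < e"
      by (intro exI[of _ "inverse (real (Suc n))"]) (simp add: algebra_simps)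
  qed
qed

lemma sets_mu [simp, measurable_cong]: "sets (mu x) = sets borel"
  and space_mu [simp]: "space (mu x) = UNIV"
  unfolding mu_def by simp_all

lemma emeasure_mu_Ioc:
  "a \<le> b \<Longrightarrow> emeasure (mu x) {a<..b} = ennreal (inner (E b x) x - inner (E a x) x)"
  unfolding mu_def by (rule emeasure_interval_measure_Ioc) (auto intro: E_form_mono E_form_continuous)

lemma emeasure_mu_UNIV: "emeasure (mu x) UNIV = ennreal ((norm x)\<^sup>2)"
proof (rule LIMSEQ_unique)
  have "(\<lambda>n. emeasure (mu x) {- real n<..real n}) \<longlonglongrightarrow> emeasure (mu x) (\<Union>n. {- real n<..real n})"
    by (intro Lim_emeasure_incseq) (auto simp: incseq_def)
  also have "(\<Union>n. {- real n<..real n}) = (UNIV :: real set)"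
  proof -
    have "\<exists>n. t \<in> {- real n<..real n}" for t
    proof -
      obtain n where "\<bar>t\<bar> < real n" using reals_Archimedean2 by blast
      then show ?thesis by (intro exI[of _ n]) auto
    qed
    then show ?thesis by auto
  qed
  finally show "(\<lambda>n. emeasure (mu x) {- real n<..real n}) \<longlonglongrightarrow> emeasure (mu x) UNIV" .
  have "(\<lambda>n. inner (E (real n) x) x - inner (E (- real n) x) x) \<longlonglongrightarrow> inner x x - inner 0 x"
    by (intro tendsto_intros E_at_top E_at_bot)
  then have "(\<lambda>n. inner (E (real n) x) x - inner (E (- real n) x) x) \<longlonglongrightarrow> (norm x)\<^sup>2"
    by (simp add: power2_norm_eq_inner)
  then show "(\<lambda>n. emeasure (mu x) {- real n<..real n}) \<longlonglongrightarrow> ennreal ((norm x)\<^sup>2)"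
    using tendsto_ennrealI by (simp add: emeasure_mu_Ioc)
qed

lemma finite_mu: "finite_measure (mu x)"
  by (rule finite_measureI) (simp add: emeasure_mu_UNIV)

lemma measure_mu_UNIV: "measure (mu x) UNIV = (norm x)\<^sup>2"
  by (simp add: measure_def emeasure_mu_UNIV)

section \<open>From scalar measures to projections\<close>

definition represents :: "('a \<Rightarrow> 'a) \<Rightarrow> real set \<Rightarrow> bool" where
  "represents Q V \<longleftrightarrow> orth_proj Q \<and> bicomm Q \<and> (\<forall>x. measure (mu x) V = inner (Q x) x)"

text \<open>Evaluate the measure of the vector \<open>Q x\<close>: disjointness gives
  \<open>V \<union> W\<close> the mass \<open>(norm (P (Q x)))^2 + (norm (Q x))^2\<close>, while the
  total mass is only \<open>(norm (Q x))^2\<close>.\<close>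

lemma represents_orth:
  assumes P: "represents P V" and Q: "represents Q W" and [measurable]: "V \<in> sets borel" "W \<in> sets borel"
    and disj: "V \<inter> W = {}"
  shows "P (Q x) = 0"
proof -
  interpret finite_measure "mu (Q x)" by (rule finite_mu)
  have proj: "orth_proj P" "orth_proj Q" using P Q unfolding represents_def by auto
  have "measure (mu (Q x)) (V \<union> W) = inner (P (Q x)) (Q x) + inner (Q (Q x)) (Q x)"
    using P Q disj unfolding represents_def by (subst finite_measure_Union) auto
  also have "\<dots> = (norm (P (Q x)))\<^sup>2 + (norm (Q x))\<^sup>2"
    by (simp add: orth_proj_inner_self[OF proj(1)] orth_proj_idem[OF proj(2)] power2_norm_eq_inner)
  finally have "(norm (P (Q x)))\<^sup>2 \<le> 0"
    using bounded_measure[of "V \<union> W"] measure_mu_UNIV[of "Q x"] by simp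
  then show ?thesis by simp
qed

text \<open>Orthogonality makes the partial sums an increasing sequence of projections, which
  converges strongly; countable additivity of the measures identifies the form of the limit.\<close>

lemma represents_union:
  assumes Q: "\<And>i. represents (Q i) (V i)" and V: "\<And>i::nat. V i \<in> sets borel" and disj: "disjoint_family V"
  obtains P where "represents P (\<Union>i. V i)" "\<And>x. (\<lambda>i. Q i x) sums P x"
proof -
  have proj: "orth_proj (Q i)" and bi: "bicomm (Q i)" for i using Q unfolding represents_def by auto
  have orth: "Q i (Q j x) = 0" if "i \<noteq> j" for i j x
    using represents_orth[OF Q Q V V] disj that unfolding disjoint_family_on_def by blast
  define P where "P n x = (\<Sum>i<n. Q i x)" for n x
  have P_Suc: "P (Suc n) = (\<lambda>x. P n x + Q n x)" for n unfolding P_def by auto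
  have P_0: "P 0 = (\<lambda>x. 0)" unfolding P_def by auto
  have projP: "orth_proj (P n)" for n
  proof (induction n)
    case (Suc n)
    have "P n (Q n x) = 0" for x unfolding P_def by (intro sum.neutral ballI orth) auto
    then show ?case unfolding P_Suc by (rule orth_proj_plus[OF Suc proj])
  qed (simp add: P_0 orth_proj_0)
  have biP: "bicomm (P n)" for n
    by (induction n) (auto simp: P_0 P_Suc intro: bicomm_0 bicomm_add bi)
  have "P m (P n x) = P n x" if "n \<le> m" for m n x
    using that
  proof (induction m rule: dec_induct)
    case (step m)
    have "Q m (P n x) = (\<Sum>j<n. Q m (Q j x))"
      unfolding P_def by (rule linear_sum[OF orth_proj_linear[OF proj]])
    also have "\<dots> = 0" using step.hyps by (intro sum.neutral ballI orth) auto
    finally show ?case using step.IH by (simp add: P_Suc)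
  qed (rule orth_proj_idem[OF projP])
  then obtain T where T: "orth_proj T" "\<And>x. (\<lambda>n. P n x) \<longlonglongrightarrow> T x"
    using orth_proj_increasing_limit[of P, OF projP] by blast
  have "measure (mu x) (\<Union>i. V i) = inner (T x) x" for x
  proof -
    interpret finite_measure "mu x" by (rule finite_mu)
    have "(\<lambda>i. measure (mu x) (V i)) sums measure (mu x) (\<Union>i. V i)"
      using V disj by (intro finite_measure_UNION) auto
    moreover have "measure (mu x) (V i) = inner (Q i x) x" for i using Q unfolding represents_def by blast
    ultimately have "(\<lambda>n. inner (P n x) x) \<longlonglongrightarrow> measure (mu x) (\<Union>i. V i)"
      unfolding sums_def P_def by (simp add: inner_sum_left)
    moreover have "(\<lambda>n. inner (P n x) x) \<longlonglongrightarrow> inner (T x) x" by (intro tendsto_intros T)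
    ultimately show ?thesis using LIMSEQ_unique by blast
  qed
  then have "represents T (\<Union>i. V i)"
    unfolding represents_def using T(1) bicomm_limit[OF biP T(2)] by blast
  then show thesis using that T(2) unfolding sums_def P_def by blast
qed

lemma represents_Ioc: "a \<le> b \<Longrightarrow> represents (\<lambda>x. E b x - E a x) {a<..b}"
  unfolding represents_def
  by (simp add: orth_proj_minus E_proj E_mono bicomm_diff E_bicomm measure_def emeasure_mu_Ioc
      E_form_mono inner_diff_left)

lemma represents_empty: "represents (\<lambda>x. 0) {}"
  unfolding represents_def by (simp add: orth_proj_0 bicomm_0)

lemma represents_exists:
  assumes "V \<in> sets borel"
  shows "\<exists>Q. represents Q V"
proof -
  let ?G = "range (\<lambda>(a, b). {a<..b :: real})"
  have sets: "sets borel = sigma_sets UNIV ?G" by (subst borel_sigma_sets_Ioc) simp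
  have "Int_stable ?G"
    unfolding Int_stable_def
  proof (intro ballI)
    fix X Y assume "X \<in> ?G" "Y \<in> ?G"
    then obtain a b c d where "X = {a<..b}" "Y = {c<..d}" by auto
    \<comment> \<open>Disjoint intervals need no separate case: \<open>{a<..b}\<close> is empty for
      \<open>b \<le> a\<close>, and such pairs also occur in \<open>?G\<close>.\<close>
    then have "X \<inter> Y = (case (max a c, min b d) of (a, b) \<Rightarrow> {a<..b})" by auto
    then show "X \<inter> Y \<in> ?G" by blast
  qed
  moreover have "?G \<subseteq> Pow UNIV" "V \<in> sigma_sets UNIV ?G" using assms sets by auto
  ultimately show ?thesis
  proof (induction rule: sigma_sets_induct_disjoint)
    case (basic X)
    then obtain a b where X: "X = {a<..b}" by auto
    show ?case
    proof (cases "a \<le> b")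
      case True then show ?thesis unfolding X using represents_Ioc by blast
    next
      case False then have "X = {}" unfolding X by auto
      then show ?thesis using represents_empty by blast
    qed
  next
    case empty
    then show ?case using represents_empty by blast
  next
    case (compl X)
    then obtain Q where Q: "represents Q X" by blast
    have [measurable]: "X \<in> sets borel" using compl(1) sets by simp
    have "measure (mu x) (UNIV - X) = inner (x - Q x) x" for x
      using finite_measure.finite_measure_compl[OF finite_mu, of X x] Q measure_mu_UNIV[of x]
      unfolding represents_def by (simp add: inner_diff_left power2_norm_eq_inner)
    then have "represents (\<lambda>x. x - Q x) (UNIV - X)"
      using Q unfolding represents_def by (auto intro: orth_proj_compl bicomm_diff bicomm_id)
    then show ?case by blast
  next
    case (union f)
    then obtain Q where Q: "\<And>i. represents (Q i) (f i)" by metis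
    have "\<And>i. f i \<in> sets borel" using union(2) sets by auto
    then show ?case using represents_union[OF Q _ union(1)] by metis
  qed
qed

definition spectral_proj :: "real set \<Rightarrow> 'a \<Rightarrow> 'a" where
  "spectral_proj V = (SOME Q. represents Q V)"

abbreviation "P \<equiv> spectral_proj"

lemma P_represents: "V \<in> sets borel \<Longrightarrow> represents (P V) V"
  unfolding spectral_proj_def using represents_exists someI_ex by metis

lemma P_proj: "V \<in> sets borel \<Longrightarrow> orth_proj (P V)"
  and P_bicomm: "V \<in> sets borel \<Longrightarrow> bicomm (P V)"
  and measure_mu: "V \<in> sets borel \<Longrightarrow> measure (mu x) V = inner (P V x) x"
  using P_represents unfolding represents_def by auto

lemma P_linear: "V \<in> sets borel \<Longrightarrow> linear (P V)"
  using P_proj orth_proj_linear by blast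

lemma P_A: "V \<in> sets borel \<Longrightarrow> x \<in> D \<Longrightarrow> A (P V x) = P V (A x)"
  using commD(2) orth_proj_comm[OF P_proj P_bicomm] by blast

lemma P_eqI: "V \<in> sets borel \<Longrightarrow> represents Q V \<Longrightarrow> P V = Q"
  using P_represents[of V] unfolding represents_def by (auto intro!: orth_proj_eqI)

lemma P_empty: "P {} = (\<lambda>x. 0)"
  by (rule P_eqI[OF _ represents_empty]) simp

lemma P_UNIV: "P UNIV = id"
proof (rule P_eqI)
  show "represents id UNIV"
    unfolding represents_def id_def
    by (simp add: orth_proj_id bicomm_id measure_mu_UNIV power2_norm_eq_inner)
qed simp

lemma P_Ioc: "a \<le> b \<Longrightarrow> P {a<..b} = (\<lambda>x. E b x - E a x)"
  by (rule P_eqI[OF _ represents_Ioc]) auto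

lemma P_disjoint: "V \<in> sets borel \<Longrightarrow> W \<in> sets borel \<Longrightarrow> V \<inter> W = {} \<Longrightarrow> P V (P W x) = 0"
  using represents_orth P_represents by blast

lemma P_sums:
  assumes "range V \<subseteq> sets borel" "disjoint_family (V :: nat \<Rightarrow> real set)"
  shows "(\<lambda>n. P (V n) x) sums P (\<Union>n. V n) x"
proof -
  have V: "V i \<in> sets borel" for i using assms(1) by auto
  obtain Q where "represents Q (\<Union>i. V i)" "\<And>x. (\<lambda>i. P (V i) x) sums Q x"
    by (rule represents_union[OF P_represents[OF V] V assms(2)]) blast
  then show ?thesis using P_eqI[of "\<Union>i. V i" Q] V by auto
qed

lemma P_union:
  assumes V: "V \<in> sets borel" and W: "W \<in> sets borel" and disj: "V \<inter> W = {}"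
  shows "P (V \<union> W) x = P V x + P W x"
proof -
  have "represents (\<lambda>x. P V x + P W x) (V \<union> W)"
    unfolding represents_def
  proof (intro conjI allI)
    show "orth_proj (\<lambda>x. P V x + P W x)"
      by (rule orth_proj_plus[OF P_proj[OF V] P_proj[OF W] P_disjoint[OF V W disj]])
    show "bicomm (\<lambda>x. P V x + P W x)" by (rule bicomm_add[OF P_bicomm[OF V] P_bicomm[OF W]])
    show "measure (mu x) (V \<union> W) = inner (P V x + P W x) x" for x
      using V W disj
      by (subst finite_measure.finite_measure_Union[OF finite_mu])
        (auto simp: measure_mu inner_add_left)
  qed
  then show ?thesis using P_eqI[of "V \<union> W"] V W by auto
qed

text \<open>Splitting both sets along \<open>V \<inter> W\<close> leaves pieces that are pairwise
  disjoint, so all mixed products vanish and only \<open>P (V \<inter> W)\<close> remains.\<close>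

lemma P_Int:
  assumes V: "V \<in> sets borel" and W: "W \<in> sets borel"
  shows "P V (P W x) = P (V \<inter> W) x"
proof -
  have sets: "V \<inter> W \<in> sets borel" "V - W \<in> sets borel" "W - V \<in> sets borel" using V W by auto
  have V': "P V x = P (V \<inter> W) x + P (V - W) x" for x
  proof -
    have "V \<inter> W \<union> (V - W) = V" "V \<inter> W \<inter> (V - W) = {}" by auto
    then show ?thesis using P_union[OF sets(1,2), of x] by simp
  qed
  have "P W x = P (V \<inter> W) x + P (W - V) x"
  proof -
    have "V \<inter> W \<union> (W - V) = W" "V \<inter> W \<inter> (W - V) = {}" by auto
    then show ?thesis using P_union[OF sets(1,3), of x] by simp
  qed
  then have "P V (P W x) = P V (P (V \<inter> W) x) + P V (P (W - V) x)"
    by (simp add: linear_add[OF P_linear[OF V]])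
  also have "P V (P (W - V) x) = 0" by (rule P_disjoint[OF V sets(3)]) auto
  also have "P V (P (V \<inter> W) x) = P (V \<inter> W) x"
    unfolding V' using P_disjoint[OF sets(2,1), of x] orth_proj_idem[OF P_proj[OF sets(1)]]
    by auto
  finally show ?thesis by simp
qed

end

section \<open>Integration over cells\<close>

text \<open>\<open>Y\<close> is a Hahn set for \<open>\<nu>\<close>, so the supremum over subsets of
  \<open>V\<close> is attained at \<open>V \<inter> Y\<close>. This closed form is also what proves
  countable additivity, without which \<open>measure_of\<close> would default to the zero
  measure.\<close>

lemma emeasure_positive_part:
  assumes sums: "\<And>V. range V \<subseteq> sets borel \<Longrightarrow> disjoint_family V \<Longrightarrow> (\<lambda>n::nat. \<nu> (V n)) sums \<nu> (\<Union>n. V n)"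
    and add: "\<And>V W. V \<in> sets borel \<Longrightarrow> W \<in> sets borel \<Longrightarrow> V \<inter> W = {} \<Longrightarrow> \<nu> (V \<union> W) = \<nu> V + \<nu> W"
    and Y: "Y \<in> sets borel"
    and pos: "\<And>V. V \<in> sets borel \<Longrightarrow> V \<subseteq> Y \<Longrightarrow> 0 \<le> \<nu> V"
    and neg: "\<And>V. V \<in> sets borel \<Longrightarrow> V \<inter> Y = {} \<Longrightarrow> \<nu> V \<le> 0"
    and V: "V \<in> sets borel"
  shows "emeasure (positive_part \<nu>) V = ennreal (\<nu> (V \<inter> Y))"
proof -
  have sup: "(SUP W\<in>{W \<in> sets borel. W \<subseteq> V}. ennreal (\<nu> W)) = ennreal (\<nu> (V \<inter> Y))" if V: "V \<in> sets borel" for V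
  proof (rule antisym)
    show "ennreal (\<nu> (V \<inter> Y)) \<le> (SUP W\<in>{W \<in> sets borel. W \<subseteq> V}. ennreal (\<nu> W))"
      using V Y by (intro SUP_upper) auto
    show "(SUP W\<in>{W \<in> sets borel. W \<subseteq> V}. ennreal (\<nu> W)) \<le> ennreal (\<nu> (V \<inter> Y))"
    proof (rule SUP_least, rule ennreal_leI)
      fix W assume W: "W \<in> {W \<in> sets borel. W \<subseteq> V}"
      have sets: "W \<inter> Y \<in> sets borel" "W - Y \<in> sets borel" "V \<inter> Y - W \<in> sets borel" using W V Y by auto
      have "W = (W \<inter> Y) \<union> (W - Y)" "V \<inter> Y = (W \<inter> Y) \<union> (V \<inter> Y - W)" using W by auto
      then have "\<nu> W = \<nu> (W \<inter> Y) + \<nu> (W - Y)" "\<nu> (V \<inter> Y) = \<nu> (W \<inter> Y) + \<nu> (V \<inter> Y - W)"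
        using add[OF sets(1,2)] add[OF sets(1,3)] by fastforce+
      moreover have "\<nu> (W - Y) \<le> 0" "0 \<le> \<nu> (V \<inter> Y - W)"
        using neg[OF sets(2)] pos[OF sets(3)] by auto
      ultimately show "\<nu> W \<le> \<nu> (V \<inter> Y)" by linarith
    qed
  qed
  have "\<nu> {} = 0" using pos[of "{}"] neg[of "{}"] by simp
  show ?thesis
    unfolding positive_part_def
  proof (subst emeasure_measure_of_sigma)
    show "sigma_algebra UNIV (sets borel :: real set set)"
      using sets.sigma_algebra_axioms[of "borel :: real measure"] by simp
    show "positive (sets borel) (\<lambda>V. SUP W\<in>{W \<in> sets borel. W \<subseteq> V}. ennreal (\<nu> W))"
      unfolding positive_def by (simp add: sup \<open>\<nu> {} = 0\<close>)
    show "countably_additive (sets borel) (\<lambda>V. SUP W\<in>{W \<in> sets borel. W \<subseteq> V}. ennreal (\<nu> W))"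
    proof (rule countably_additiveI)
      fix B :: "nat \<Rightarrow> real set"
      assume B: "range B \<subseteq> sets borel" "disjoint_family B" "(\<Union>i. B i) \<in> sets borel"
      have "(\<lambda>i. \<nu> (B i \<inter> Y)) sums \<nu> (\<Union>i. B i \<inter> Y)"
        using B Y by (intro sums) (auto simp: disjoint_family_on_def)
      then have "(\<Sum>i. ennreal (\<nu> (B i \<inter> Y))) = ennreal (\<nu> (\<Union>i. B i \<inter> Y))"
        using B Y pos by (intro suminf_ennreal_eq) auto
      then show "(\<Sum>i. SUP W\<in>{W \<in> sets borel. W \<subseteq> B i}. ennreal (\<nu> W))
          = (SUP W\<in>{W \<in> sets borel. W \<subseteq> (\<Union>i. B i)}. ennreal (\<nu> W))"
        using B by (subst (1 2) sup) auto
    qed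
  qed (simp_all add: V sup)
qed

lemma sets_positive_part [simp, measurable_cong]: "sets (positive_part \<nu>) = sets borel"
  and space_positive_part [simp]: "space (positive_part \<nu>) = UNIV"
  unfolding positive_part_def
  using sets.sigma_sets_eq[of "borel :: real measure"] by (simp_all add: sets_measure_of_conv space_measure_of_conv)

text \<open>Enumerating the integers by naturals lets sums over all cells be ordinary series, as in
  the countable additivity of \<open>P\<close>. The grid point is the right end of its cell.\<close>

definition grid :: "real \<Rightarrow> nat \<Rightarrow> real" where
  "grid h i = h * real_of_int (int_decode i)"

definition cell :: "real \<Rightarrow> nat \<Rightarrow> real set" where
  "cell h i = {grid h i - h<..grid h i}"

lemma cell_iff: "0 < h \<Longrightarrow> t \<in> cell h i \<longleftrightarrow> \<lceil>t / h\<rceil> = int_decode i"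
  unfolding cell_def grid_def by (auto simp: ceiling_eq_iff field_simps)

lemma cell_sets [simp, measurable]: "cell h i \<in> sets borel"
  unfolding cell_def by simp

lemma cell_disjoint: "0 < h \<Longrightarrow> disjoint_family (cell h)"
  unfolding disjoint_family_on_def
  by (auto simp: cell_iff) (metis injD inj_int_decode)

lemma cell_cover: "0 < h \<Longrightarrow> (\<Union>i. cell h i) = UNIV"
proof -
  assume h: "0 < h"
  have "t \<in> cell h (int_encode \<lceil>t / h\<rceil>)" for t using h by (simp add: cell_iff)
  then show ?thesis by blast
qed

lemma cell_bound: "t \<in> cell h i \<Longrightarrow> \<bar>t - grid h i\<bar> \<le> h"
  unfolding cell_def by auto

lemma cell_integral_sums:
  assumes "sets N = sets borel" "integrable N (f :: real \<Rightarrow> real)" "0 < h"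
  shows "(\<lambda>i. LINT t:cell h i|N. f t) sums (LINT t|N. f t)"
proof -
  have [measurable]: "cell h i \<in> sets N" for i using assms(1) by simp
  have int: "set_integrable N V f" if "V \<in> sets N" for V
    using assms(2) that unfolding set_integrable_def by (rule integrable_mult_indicator[rotated])
  have cover: "(\<Union>n. \<Union>i<n. cell h i) = UNIV" using cell_cover[OF assms(3)] by blast
  have "(\<lambda>n. LINT t:(\<Union>i<n. cell h i)|N. f t) \<longlonglongrightarrow> (LINT t:(\<Union>n. \<Union>i<n. cell h i)|N. f t)"
  proof (rule set_integral_cont_up)
    show "incseq (\<lambda>n. \<Union>i<n. cell h i)" by (force simp: incseq_def)
    show "set_integrable N (\<Union>n. \<Union>i<n. cell h i) f" by (rule int) measurable
  qed measurable
  moreover have "(LINT t:(\<Union>i<n. cell h i)|N. f t) = (\<Sum>i<n. LINT t:cell h i|N. f t)" for n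
    using cell_disjoint[OF assms(3)]
    by (intro set_integral_finite_Union int) (auto simp: disjoint_family_on_def)
  ultimately show ?thesis unfolding sums_def cover by (simp add: set_lebesgue_integral_def)
qed

lemma cell_nn_integral:
  assumes "sets N = sets borel" "f \<in> borel_measurable N" "0 < h"
  shows "(\<integral>\<^sup>+t. f t \<partial>N) = (\<Sum>i. \<integral>\<^sup>+t\<in>cell h i. f t \<partial>N)"
  using nn_integral_disjoint_family[OF assms(2) _ cell_disjoint[OF assms(3)]]
  by (simp add: assms(1) cell_cover[OF assms(3)])

lemma sums_abs_le:
  fixes f g :: "nat \<Rightarrow> real"
  assumes "f sums a" "g sums b" "\<And>i. \<bar>f i\<bar> \<le> g i"
  shows "\<bar>a\<bar> \<le> b"
proof -
  have "a \<le> b" by (rule sums_le[OF _ assms(1,2)]) (use assms(3) abs_le_D1 in blast)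
  moreover have "- a \<le> b" by (rule sums_le[OF _ sums_minus[OF assms(1)] assms(2)]) (use assms(3) abs_le_D2 in blast)
  ultimately show ?thesis by linarith
qed

context real_self_adjoint
begin

section \<open>The operator on a single cell\<close>

lemma P_cell:
  assumes "0 < h" "P (cell h i) x = x"
  shows "x \<in> D" "norm (A x - grid h i *\<^sub>R x) \<le> h * norm x"
proof -
  define b where "b = grid h i"
  have P_eq: "P (cell h i) = (\<lambda>x. E b x - E (b - h) x)"
    unfolding cell_def b_def using assms(1) by (intro P_Ioc) simp
  \<comment> \<open>A vector of the cell is fixed by \<open>E b\<close> and killed by
    \<open>E (b - h)\<close>, so the form of \<open>A - b\<close> lies between \<open>- h\<close>
    and \<open>0\<close> times the squared norm.\<close>
  have bound: "\<bar>inner (A x - b *\<^sub>R x) x\<bar> \<le> h * inner x x" if x: "x \<in> D" "P (cell h i) x = x" for x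
  proof -
    have x': "E b x - E (b - h) x = x" using x(2) P_eq by simp
    have "E b (E b x - E (b - h) x) = E b x - E (b - h) x"
      using assms(1)
      by (simp add: linear_diff[OF orth_proj_linear[OF E_proj]] orth_proj_idem[OF E_proj] E_mono)
    then have "E b x = x" by (simp only: x')
    moreover from this have "E (b - h) x = 0" using x' by simp
    ultimately have "inner (A x) x \<le> b * inner x x" "(b - h) * inner x x \<le> inner (A x) x"
      using E_upper[OF x(1), of b] E_lower[OF x(1), of "b - h"] by auto
    then show ?thesis by (simp add: inner_diff_left left_diff_distrib)
  qed
  have proj: "orth_proj (P (cell h i))" by (rule P_proj) simp
  have comm: "comm (P (cell h i))" by (rule orth_proj_comm[OF proj P_bicomm]) simp
  have h: "0 \<le> h" using assms(1) by simp
  show "x \<in> D" by (rule form_bound(1)[OF proj comm h bound assms(2)])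
  show "norm (A x - grid h i *\<^sub>R x) \<le> h * norm x"
    unfolding b_def[symmetric] by (rule form_bound(2)[OF proj comm h bound assms(2)])
qed

lemma P_idem: "V \<in> sets borel \<Longrightarrow> P V (P V x) = P V x"
  using orth_proj_idem P_proj by blast

lemma P_inner: "V \<in> sets borel \<Longrightarrow> inner (P V x) y = inner x (P V y)"
  using orth_proj_inner P_proj by blast

lemma cell_part_in_D: "0 < h \<Longrightarrow> P (cell h i) x \<in> D"
  by (rule P_cell(1)[of h i]) (simp_all add: P_idem)

lemma cell_part_bound:
  "0 < h \<Longrightarrow> norm (A (P (cell h i) x) - grid h i *\<^sub>R P (cell h i) x) \<le> h * norm (P (cell h i) x)"
  by (rule P_cell(2)[of h i]) (simp_all add: P_idem)

lemma cell_part_norm: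
  assumes "0 < h"
  shows "\<bar>grid h i\<bar> * norm (P (cell h i) x) \<le> norm (A (P (cell h i) x)) + h * norm (P (cell h i) x)"
    and "norm (A (P (cell h i) x)) \<le> (\<bar>grid h i\<bar> + h) * norm (P (cell h i) x)"
  using cell_part_bound[OF assms, of i x]
    norm_triangle_ineq2[of "grid h i *\<^sub>R P (cell h i) x" "A (P (cell h i) x)"]
    norm_triangle_ineq2[of "A (P (cell h i) x)" "grid h i *\<^sub>R P (cell h i) x"]
  by (simp_all add: norm_minus_commute distrib_right)

lemma cell_parts_sums: "0 < h \<Longrightarrow> (\<lambda>i. P (cell h i) x) sums x"
  using P_sums[OF _ cell_disjoint, of h x] by (simp add: cell_cover P_UNIV image_subset_iff)

lemma norm_P_square: "V \<in> sets borel \<Longrightarrow> (norm (P V x))\<^sup>2 = inner (P V x) x"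
  using orth_proj_inner_self[OF P_proj] by simp

lemma cell_norms_sums: "0 < h \<Longrightarrow> (\<lambda>i. (norm (P (cell h i) x))\<^sup>2) sums (norm x)\<^sup>2"
  using bounded_linear.sums[OF bounded_linear_inner_left cell_parts_sums, of h x x]
  by (simp add: norm_P_square power2_norm_eq_inner[of x])

section \<open>The domain and second moments\<close>

lemma emeasure_mu: "V \<in> sets borel \<Longrightarrow> emeasure (mu x) V = ennreal ((norm (P V x))\<^sup>2)"
  by (simp add: finite_measure.emeasure_eq_measure[OF finite_mu] measure_mu norm_P_square)

text \<open>The weight \<open>\<bar>grid 1 i\<bar> + 1\<close> dominates the identity on the cell.
  Since \<open>P\<close> commutes with \<open>A\<close>, the weighted component of \<open>x\<close>
  is controlled by the component of \<open>A x\<close>, and the latter are square summable.\<close>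

lemma unit_cell_weight_le:
  assumes x: "x \<in> D"
  shows "(\<bar>grid 1 i\<bar> + 1) * norm (P (cell 1 i) x) \<le> norm (P (cell 1 i) (A x)) + 2 * norm (P (cell 1 i) x)"
  using cell_part_norm(1)[of 1 i x] P_A[OF _ x, of "cell 1 i"] by (simp add: distrib_right)

lemma second_moment_finite:
  assumes x: "x \<in> D"
  shows "(\<integral>\<^sup>+t. ennreal (t\<^sup>2) \<partial>mu x) < \<infinity>"
proof -
  let ?p = "\<lambda>i. norm (P (cell 1 i) x)" and ?q = "\<lambda>i. norm (P (cell 1 i) (A x))"
  \<comment> \<open>From \<open>(q + 2 p)^2 \<le> 2 q^2 + 8 p^2\<close>, with \<open>q + 2 p\<close>
    the bound in \<open>unit_cell_weight_le\<close>.\<close>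
  define g where "g i = 2 * (?q i)\<^sup>2 + 8 * (?p i)\<^sup>2" for i
  have "summable g"
    unfolding g_def by (intro summable_add summable_mult sums_summable[OF cell_norms_sums]) auto
  have "(\<integral>\<^sup>+t\<in>cell 1 i. ennreal (t\<^sup>2) \<partial>mu x) \<le> ennreal (g i)" for i
  proof -
    define k where "k = (\<bar>grid 1 i\<bar> + 1)\<^sup>2"
    have "t\<^sup>2 \<le> k" if "t \<in> cell 1 i" for t
    proof -
      have "\<bar>t\<bar> \<le> \<bar>\<bar>grid 1 i\<bar> + 1\<bar>" using cell_bound[OF that] by linarith
      then show ?thesis unfolding k_def by (simp only: abs_le_square_iff)
    qed
    then have "(\<integral>\<^sup>+t\<in>cell 1 i. ennreal (t\<^sup>2) \<partial>mu x) \<le> (\<integral>\<^sup>+t. ennreal k * indicator (cell 1 i) t \<partial>mu x)"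
      by (intro nn_integral_mono) (auto split: split_indicator intro: ennreal_leI)
    also have "\<dots> = ennreal (k * (?p i)\<^sup>2)"
      unfolding k_def by (subst nn_integral_cmult_indicator) (auto simp: emeasure_mu ennreal_mult)
    also have "k * (?p i)\<^sup>2 \<le> (?q i + 2 * ?p i)\<^sup>2"
      unfolding k_def power_mult_distrib[symmetric]
      using unit_cell_weight_le[OF x] by (intro power_mono) auto
    also have "\<dots> \<le> g i"
      unfolding g_def using zero_le_power2[of "?q i - 2 * ?p i"]
      by (simp add: power2_eq_square algebra_simps)
    finally show ?thesis by (simp add: ennreal_leI)
  qed
  then have "(\<integral>\<^sup>+t. ennreal (t\<^sup>2) \<partial>mu x) \<le> (\<Sum>i. ennreal (g i))"
    by (subst cell_nn_integral[where h = 1]) (auto intro!: suminf_le)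
  also have "\<dots> = ennreal (\<Sum>i. g i)"
    by (rule suminf_ennreal2[OF _ \<open>summable g\<close>]) (simp add: g_def)
  also have "\<dots> < \<infinity>" by simp
  finally show ?thesis .
qed

text \<open>Finite sums of cell components of \<open>x\<close> lie in \<open>D\<close> and converge
  to \<open>x\<close>. Their images under \<open>A\<close> have orthogonal increments whose squared
  norms are summable by the moment condition, so they converge too and closedness of
  \<open>A\<close> applies.\<close>

lemma in_D_if_second_moment_finite:
  assumes fin: "(\<integral>\<^sup>+t. ennreal (t\<^sup>2) \<partial>mu x) < \<infinity>"
  shows "x \<in> D"
proof -
  let ?p = "\<lambda>i. P (cell 1 i) x"
  define w where "w i = ((\<bar>grid 1 i\<bar> + 1) * norm (?p i))\<^sup>2" for i
  have le: "ennreal (w i) \<le> (\<integral>\<^sup>+t\<in>cell 1 i. ennreal (2 * t\<^sup>2 + 8) \<partial>mu x)" for i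
  proof -
    define k where "k = (\<bar>grid 1 i\<bar> + 1)\<^sup>2"
    have "k \<le> 2 * t\<^sup>2 + 8" if "t \<in> cell 1 i" for t
    proof -
      \<comment> \<open>The grid point is within \<open>1\<close> of \<open>t\<close>, and the
        weight adds another \<open>1\<close>.\<close>
      have "k \<le> (\<bar>t\<bar> + 2)\<^sup>2"
        unfolding k_def using cell_bound[OF that] by (intro power_mono) linarith+
      also have "\<dots> \<le> 2 * t\<^sup>2 + 8"
        using zero_le_power2[of "\<bar>t\<bar> - 2"] by (simp add: power2_eq_square algebra_simps)
      finally show ?thesis .
    qed
    then have "(\<integral>\<^sup>+t. ennreal k * indicator (cell 1 i) t \<partial>mu x)
        \<le> (\<integral>\<^sup>+t\<in>cell 1 i. ennreal (2 * t\<^sup>2 + 8) \<partial>mu x)"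
      by (intro nn_integral_mono) (auto split: split_indicator intro: ennreal_leI simp del: ennreal_plus)
    moreover have "(\<integral>\<^sup>+t. ennreal k * indicator (cell 1 i) t \<partial>mu x) = ennreal (w i)"
      unfolding k_def w_def power_mult_distrib
      by (subst nn_integral_cmult_indicator) (auto simp: emeasure_mu ennreal_mult)
    ultimately show ?thesis by simp
  qed
  have "(\<Sum>i. ennreal (w i)) \<le> (\<Sum>i. \<integral>\<^sup>+t\<in>cell 1 i. ennreal (2 * t\<^sup>2 + 8) \<partial>mu x)"
    by (intro suminf_le le) auto
  also have "\<dots> = (\<integral>\<^sup>+t. ennreal (2 * t\<^sup>2 + 8) \<partial>mu x)"
    by (rule cell_nn_integral[symmetric]) auto
  also have "\<dots> = (\<integral>\<^sup>+t. 2 * ennreal (t\<^sup>2) + 8 \<partial>mu x)"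
    by (intro nn_integral_cong) (simp add: ennreal_plus ennreal_mult)
  also have "\<dots> = 2 * (\<integral>\<^sup>+t. ennreal (t\<^sup>2) \<partial>mu x) + 8 * emeasure (mu x) UNIV"
    by (subst nn_integral_add) (auto simp: nn_integral_cmult)
  also have "\<dots> < \<infinity>"
    using fin by (simp add: emeasure_mu_UNIV ennreal_mult_less_top)
  finally have "summable w"
    by (intro summable_suminf_not_top) (auto simp: w_def)
  \<comment> \<open>\<open>A\<close> does not leave the range of the cell, so images from different
    cells are orthogonal.\<close>
  have AP: "A (?p i) = P (cell 1 i) (A (?p i))" for i
    using P_A[OF cell_sets cell_part_in_D[of 1 i x], of 1 i] by (simp add: P_idem)
  have orth: "inner (A (?p i)) (A (?p j)) = 0" if "i \<noteq> j" for i j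
  proof -
    have "cell 1 j \<inter> cell 1 i = {}"
      using cell_disjoint[of 1] that unfolding disjoint_family_on_def by auto
    then have "P (cell 1 j) (P (cell 1 i) (A (?p i))) = 0" by (intro P_disjoint) auto
    then have "P (cell 1 j) (A (?p i)) = 0" using AP by metis
    then show ?thesis using AP[of j] P_inner[of "cell 1 j" "A (?p i)" "A (?p j)"] by simp
  qed
  have "summable (\<lambda>i. (norm (A (?p i)))\<^sup>2)"
  proof (rule summable_comparison_test'[OF \<open>summable w\<close>])
    show "norm ((norm (A (?p i)))\<^sup>2) \<le> w i" for i
      unfolding w_def using cell_part_norm(2)[of 1 i x] by (simp add: power_mono)
  qed
  define y where "y n = (\<Sum>i<n. ?p i)" for n
  have y: "y n \<in> D \<and> A (y n) = (\<Sum>i<n. A (?p i))" for n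
    unfolding y_def
  proof (induction n)
    case (Suc n)
    then show ?case using D_add[OF _ cell_part_in_D[of 1 n x], of "\<Sum>i<n. ?p i"] by simp
  qed (simp add: D_0)
  have "convergent (\<lambda>n. A (y n))"
  proof (rule convergent_of_square_bound)
    show "convergent (\<lambda>n. \<Sum>i<n. (norm (A (?p i)))\<^sup>2)"
      using \<open>summable (\<lambda>i. (norm (A (?p i)))\<^sup>2)\<close> summable_iff_convergent by blast
    fix m n :: nat assume nm: "n \<le> m"
    have split: "(\<Sum>i<m. f i) - (\<Sum>i<n. f i) = (\<Sum>i=n..<m. f i)" for f :: "nat \<Rightarrow> 'z::ab_group_add"
      using sum.atLeastLessThan_concat[of 0 n m f] nm by (simp add: atLeast0LessThan algebra_simps)
    have diff: "A (y m) - A (y n) = (\<Sum>i=n..<m. A (?p i))" using y split by simp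
    have "(norm (A (y m) - A (y n)))\<^sup>2 = (\<Sum>i=n..<m. (norm (A (?p i)))\<^sup>2)"
      unfolding diff by (rule norm_sum_Pythagorean) (auto simp: pairwise_def orthogonal_def orth)
    then show "(norm (A (y m) - A (y n)))\<^sup>2
        \<le> \<bar>(\<Sum>i<m. (norm (A (?p i)))\<^sup>2) - (\<Sum>i<n. (norm (A (?p i)))\<^sup>2)\<bar>"
      unfolding split by simp
  qed
  then obtain z where "(\<lambda>n. A (y n)) \<longlonglongrightarrow> z" unfolding convergent_def by blast
  moreover have "y \<longlonglongrightarrow> x" using cell_parts_sums[of 1 x] unfolding sums_def y_def by simp
  ultimately show ?thesis using D_closed[of y x z] y by blast
qed

lemma D_iff: "x \<in> D \<longleftrightarrow> (\<integral>\<^sup>+t. ennreal (t\<^sup>2) \<partial>mu x) < \<infinity>"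
  using second_moment_finite in_D_if_second_moment_finite by blast

text \<open>The bound on sets is the Cauchy-Schwarz estimate available for both Jordan parts of
  \<open>V \<mapsto> inner (P V y) x\<close>. On each unit cell the size of the integrand is
  absorbed into the component of \<open>A x\<close>, leaving a product of two square summable
  sequences.\<close>

lemma integrable_dominated:
  assumes N: "sets N = sets borel" "\<And>V. V \<in> sets borel \<Longrightarrow> emeasure N V \<le> ennreal (norm (P V x) * norm (P V y))"
    and x: "x \<in> D"
  shows "integrable N (\<lambda>t. t)"
proof (rule integrableI_bounded)
  have [measurable_cong]: "sets N = sets borel" by (rule N(1))
  show "(\<lambda>t. t) \<in> borel_measurable N" by measurable
  let ?p = "\<lambda>i. norm (P (cell 1 i) x)" and ?q = "\<lambda>i. norm (P (cell 1 i) (A x))"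
    and ?r = "\<lambda>i. norm (P (cell 1 i) y)"
  \<comment> \<open>An upper bound for \<open>(q + 2 p) * r\<close> by the arithmetic-geometric mean
    inequality.\<close>
  define g where "g i = (?q i)\<^sup>2 + 4 * (?p i)\<^sup>2 + (?r i)\<^sup>2" for i
  have "summable g"
    unfolding g_def by (intro summable_add summable_mult sums_summable[OF cell_norms_sums]) auto
  have "(\<integral>\<^sup>+t\<in>cell 1 i. ennreal (norm t) \<partial>N) \<le> ennreal (g i)" for i
  proof -
    define k where "k = \<bar>grid 1 i\<bar> + 1"
    have "0 \<le> k" unfolding k_def by simp
    have "norm t \<le> k" if "t \<in> cell 1 i" for t
      unfolding k_def real_norm_def using cell_bound[OF that] by linarith
    then have "(\<integral>\<^sup>+t\<in>cell 1 i. ennreal (norm t) \<partial>N) \<le> (\<integral>\<^sup>+t. ennreal k * indicator (cell 1 i) t \<partial>N)"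
      by (intro nn_integral_mono) (auto split: split_indicator intro: ennreal_leI)
    also have "\<dots> = ennreal k * emeasure N (cell 1 i)"
      using N(1) by (intro nn_integral_cmult_indicator) simp
    also have "\<dots> \<le> ennreal k * ennreal (?p i * ?r i)"
      by (intro mult_left_mono N(2)) auto
    also have "\<dots> = ennreal ((k * ?p i) * ?r i)"
      using \<open>0 \<le> k\<close> by (simp add: ennreal_mult[symmetric] mult.assoc)
    also have "(k * ?p i) * ?r i \<le> (?q i + 2 * ?p i) * ?r i"
      unfolding k_def using unit_cell_weight_le[OF x] by (intro mult_right_mono) auto
    also have "\<dots> \<le> g i"
    proof -
      have "0 \<le> (?q i + 2 * ?p i - ?r i)\<^sup>2 + (?q i - 2 * ?p i)\<^sup>2 + (?r i)\<^sup>2" by simp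
      then show ?thesis unfolding g_def by (simp add: power2_eq_square algebra_simps)
    qed
    finally show ?thesis by (simp add: ennreal_leI)
  qed
  then have "(\<integral>\<^sup>+t. ennreal (norm t) \<partial>N) \<le> (\<Sum>i. ennreal (g i))"
    by (subst cell_nn_integral[where h = 1]) (auto intro!: suminf_le simp: N(1))
  also have "\<dots> = ennreal (\<Sum>i. g i)"
    by (rule suminf_ennreal2[OF _ \<open>summable g\<close>]) (simp add: g_def)
  also have "\<dots> < \<infinity>" by simp
  finally show "(\<integral>\<^sup>+t. ennreal (norm t) \<partial>N) < \<infinity>" .
qed

lemma cell_integral_estimate:
  assumes N: "sets N = sets borel" "finite_measure N" and int: "integrable N (\<lambda>t. t)" and h: "0 < h"
  shows "\<bar>(LINT t:cell h i|N. t) - grid h i * measure N (cell h i)\<bar> \<le> h * measure N (cell h i)"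
proof -
  interpret finite_measure N by (rule N(2))
  have [measurable]: "cell h i \<in> sets N" using N(1) by simp
  have I: "integrable N (\<lambda>t. indicator (cell h i) t * t)"
    using integrable_mult_indicator[OF _ int, of "cell h i"] by simp
  have Ic: "integrable N (\<lambda>t. indicator (cell h i) t * c)" for c :: real
    by (intro integrable_mult_left integrable_real_indicator) (auto simp: less_top[symmetric])
  have space: "space N = UNIV" using sets_eq_imp_space_eq[OF N(1)] by simp
  have c: "(LINT t|N. indicator (cell h i) t * c) = c * measure N (cell h i)" for c :: real
    by (simp add: space)
  have "(LINT t:cell h i|N. t) - grid h i * measure N (cell h i)
      = (LINT t|N. indicator (cell h i) t * t - indicator (cell h i) t * grid h i)"
    unfolding Bochner_Integration.integral_diff[OF I Ic] c by (simp add: set_lebesgue_integral_def)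
  also have "\<bar>\<dots>\<bar> \<le> (LINT t|N. indicator (cell h i) t * h)"
  proof (rule integral_abs_bound_integral)
    show "integrable N (\<lambda>t. indicator (cell h i) t * t - indicator (cell h i) t * grid h i)"
      by (rule Bochner_Integration.integrable_diff[OF I Ic])
    show "\<bar>indicator (cell h i) t * t - indicator (cell h i) t * grid h i\<bar> \<le> indicator (cell h i) t * h" for t
      using cell_bound[of t h i] by (auto split: split_indicator)
  qed (rule Ic)
  also have "\<dots> = h * measure N (cell h i)" by (rule c)
  finally show ?thesis .
qed

text \<open>Over a cell of width \<open>h\<close>, the integrals and
  \<open>inner (P (cell h i) y) (A x)\<close> are all compared with the grid point times the mass of
  the cell. The errors sum to a multiple of \<open>h\<close>, which tends to zero.\<close>

lemma signed_integral:
  assumes x: "x \<in> D"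
  shows "has_signed_integral id (\<lambda>V. inner (P V y) x) (inner y (A x))"
proof -
  define \<nu> where "\<nu> V = inner (P V y) x" for V
  \<comment> \<open>Polarisation: the difference of the forms of \<open>P V\<close> at
    \<open>(y + x) / 2\<close> and \<open>(y - x) / 2\<close> is \<open>inner (P V y) x\<close>. A
    Hahn set for these two positive measures serves \<open>\<nu>\<close>.\<close>
  define M1 where "M1 = mu ((1/2) *\<^sub>R (y + x))"
  define M2 where "M2 = mu ((1/2) *\<^sub>R (y - x))"
  have polar: "measure M1 V - measure M2 V = \<nu> V" if V: "V \<in> sets borel" for V
  proof -
    have "inner (P V x) y = inner (P V y) x" using P_inner[OF V] by (simp add: inner_commute)
    then show ?thesis
      unfolding M1_def M2_def \<nu>_def measure_mu[OF V]
      by (simp add: linear_add[OF P_linear[OF V]] linear_diff[OF P_linear[OF V]] linear_scale[OF P_linear[OF V]]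
          inner_add_left inner_add_right inner_diff_left inner_diff_right field_simps)
  qed
  have sums: "(\<lambda>n::nat. \<nu> (V n)) sums \<nu> (\<Union>n. V n)" if "range V \<subseteq> sets borel" "disjoint_family V" for V
    unfolding \<nu>_def by (rule bounded_linear.sums[OF bounded_linear_inner_left P_sums[OF that]])
  have add: "\<nu> (V \<union> W) = \<nu> V + \<nu> W" if "V \<in> sets borel" "W \<in> sets borel" "V \<inter> W = {}" for V W
    unfolding \<nu>_def P_union[OF that] by (rule inner_add_left)
  have fin: "finite_measure M1" "finite_measure M2" unfolding M1_def M2_def by (rule finite_mu)+
  obtain Y where Y: "Y \<in> sets M1" and
    pos': "\<And>X. X \<in> sets M1 \<Longrightarrow> X \<subseteq> Y \<Longrightarrow> emeasure M2 X \<le> emeasure M1 X" and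
    neg': "\<And>X. X \<in> sets M1 \<Longrightarrow> X \<inter> Y = {} \<Longrightarrow> emeasure M1 X \<le> emeasure M2 X"
    using finite_unsigned_Hahn_decomposition[OF fin] unfolding M1_def M2_def by auto
  have setsM: "sets M1 = sets borel" unfolding M1_def by simp
  have Y: "Y \<in> sets borel" using Y setsM by simp
  have pos: "0 \<le> \<nu> V" if "V \<in> sets borel" "V \<subseteq> Y" for V
    using pos'[of V] that polar[OF that(1)]
    by (simp add: finite_measure.emeasure_eq_measure[OF fin(1)] finite_measure.emeasure_eq_measure[OF fin(2)] setsM)
  have neg: "\<nu> V \<le> 0" if "V \<in> sets borel" "V \<inter> Y = {}" for V
    using neg'[of V] that polar[OF that(1)]
    by (simp add: finite_measure.emeasure_eq_measure[OF fin(1)] finite_measure.emeasure_eq_measure[OF fin(2)] setsM)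
  define N1 where "N1 = positive_part \<nu>"
  define N2 where "N2 = negative_part \<nu>"
  have sets: "sets N1 = sets borel" "sets N2 = sets borel"
    unfolding N1_def N2_def negative_part_def by simp_all
  have space: "space N1 = UNIV" "space N2 = UNIV"
    unfolding N1_def N2_def negative_part_def by simp_all
  have N1: "emeasure N1 V = ennreal (\<nu> (V \<inter> Y))" if "V \<in> sets borel" for V
    unfolding N1_def by (rule emeasure_positive_part[OF sums add Y pos neg that])
  have N2: "emeasure N2 V = ennreal (- \<nu> (V \<inter> - Y))" if "V \<in> sets borel" for V
    unfolding N2_def negative_part_def
  proof (rule emeasure_positive_part)
    show "(\<lambda>n::nat. - \<nu> (W n)) sums - \<nu> (\<Union>n. W n)" if "range W \<subseteq> sets borel" "disjoint_family W" for W
      by (rule sums_minus[OF sums[OF that]])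
    show "- \<nu> (V \<union> W) = - \<nu> V + - \<nu> W" if "V \<in> sets borel" "W \<in> sets borel" "V \<inter> W = {}" for V W
      using add[OF that] by simp
    show "0 \<le> - \<nu> V" if "V \<in> sets borel" "V \<subseteq> - Y" for V using neg[OF that(1)] that(2) by auto
    show "- \<nu> V \<le> 0" if "V \<in> sets borel" "V \<inter> - Y = {}" for V using pos[OF that(1)] that(2) by auto
  qed (use that Y in auto)
  have bound: "\<bar>\<nu> (V \<inter> Z)\<bar> \<le> norm (P V x) * norm (P V y)" if V: "V \<in> sets borel" and Z: "Z \<in> sets borel" for V Z
  proof -
    \<comment> \<open>A factor \<open>P V\<close> on both sides localises both vectors to
      \<open>V\<close>, so that the bound remains summable over cells.\<close>
    have "P (V \<inter> Z) y = P V (P Z (P V y))"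
      using P_Int[OF Z V] P_Int[OF V, of "Z \<inter> V"] V Z by (simp add: Int_ac)
    then have "\<nu> (V \<inter> Z) = inner (P Z (P V y)) (P V x)" unfolding \<nu>_def by (simp add: P_inner[OF V])
    also have "\<bar>\<dots>\<bar> \<le> norm (P Z (P V y)) * norm (P V x)" by (rule Cauchy_Schwarz_ineq2)
    also have "\<dots> \<le> norm (P V y) * norm (P V x)"
      using orth_proj_norm_le[OF P_proj[OF Z]] by (simp add: mult_right_mono)
    finally show ?thesis by (simp add: mult.commute)
  qed
  have dom1: "emeasure N1 V \<le> ennreal (norm (P V x) * norm (P V y))" if "V \<in> sets borel" for V
    unfolding N1[OF that] using bound[OF that Y] by (intro ennreal_leI) linarith
  have dom2: "emeasure N2 V \<le> ennreal (norm (P V x) * norm (P V y))" if "V \<in> sets borel" for V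
    unfolding N2[OF that] using bound[OF that, of "- Y"] Y by (intro ennreal_leI) (simp add: Compl_eq_Diff_UNIV)
  have int: "integrable N1 (\<lambda>t. t)" "integrable N2 (\<lambda>t. t)"
    using integrable_dominated[OF sets(1) dom1 x] integrable_dominated[OF sets(2) dom2 x] by auto
  have finN: "finite_measure N1" "finite_measure N2"
    by (rule finite_measureI, simp add: space N1 N2)+
  have m1: "measure N1 V = \<nu> (V \<inter> Y)" if V: "V \<in> sets borel" for V
    using N1[OF V] pos[of "V \<inter> Y"] V Y by (simp add: measure_def)
  have m2: "measure N2 V = - \<nu> (V \<inter> - Y)" if V: "V \<in> sets borel" for V
    using N2[OF V] neg[of "V \<inter> - Y"] V Y by (simp add: measure_def Int_assoc)
  have m12: "measure N1 V - measure N2 V = \<nu> V" if V: "V \<in> sets borel" for V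
  proof -
    have "V \<inter> Y \<union> V \<inter> - Y = V" by auto
    then show ?thesis using add[of "V \<inter> Y" "V \<inter> - Y"] V Y by (auto simp: m1 m2)
  qed
  define c where "c = (LINT t|N1. t) - (LINT t|N2. t)"
  have le: "\<bar>c - inner y (A x)\<bar> \<le> h * (2 * ((norm x)\<^sup>2 + (norm y)\<^sup>2))" if h: "0 < h" for h
  proof (rule sums_abs_le)
    show "(\<lambda>i. (LINT t:cell h i|N1. t) - (LINT t:cell h i|N2. t) - inner (P (cell h i) y) (A x))
        sums (c - inner y (A x))"
      unfolding c_def
      by (intro sums_diff cell_integral_sums sets int h
          bounded_linear.sums[OF bounded_linear_inner_left] cell_parts_sums)
    show "(\<lambda>i. h * (2 * ((norm (P (cell h i) x))\<^sup>2 + (norm (P (cell h i) y))\<^sup>2)))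
        sums (h * (2 * ((norm x)\<^sup>2 + (norm y)\<^sup>2)))"
      by (intro sums_mult sums_add cell_norms_sums h)
    fix i
    define p where "p = P (cell h i) x"
    define r where "r = P (cell h i) y"
    define k where "k = grid h i"
    have "inner r (A x) = inner r (A p)"
    proof -
      have "inner r (A x) = inner (P (cell h i) r) (A x)" unfolding r_def by (simp add: P_idem)
      also have "\<dots> = inner r (A p)" unfolding p_def by (simp add: P_inner P_A x)
      finally show ?thesis .
    qed
    also have "\<dots> = k * inner r p + inner r (A p - k *\<^sub>R p)" by (simp add: inner_diff_right)
    also have "inner r p = \<nu> (cell h i)"
      unfolding r_def p_def \<nu>_def by (simp add: P_inner P_idem)
    finally have e3: "inner r (A x) = k * \<nu> (cell h i) + inner r (A p - k *\<^sub>R p)" .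
    have "\<bar>inner r (A p - k *\<^sub>R p)\<bar> \<le> norm r * norm (A p - k *\<^sub>R p)" by (rule Cauchy_Schwarz_ineq2)
    also have "\<dots> \<le> norm r * (h * norm p)"
      unfolding p_def k_def using cell_part_bound[OF h] by (intro mult_left_mono) auto
    finally have b3: "\<bar>inner r (A p - k *\<^sub>R p)\<bar> \<le> h * (norm p * norm r)" by (simp add: mult_ac)
    have "measure N1 (cell h i) \<le> norm p * norm r" "measure N2 (cell h i) \<le> norm p * norm r"
      using bound[of "cell h i" Y] bound[of "cell h i" "- Y"] Y unfolding m1[OF cell_sets] m2[OF cell_sets] p_def r_def
      by auto
    then have "h * measure N1 (cell h i) \<le> h * (norm p * norm r)" "h * measure N2 (cell h i) \<le> h * (norm p * norm r)"
      using h by (auto intro: mult_left_mono)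
    then have b12: "\<bar>(LINT t:cell h i|N1. t) - k * measure N1 (cell h i)\<bar> \<le> h * (norm p * norm r)"
      "\<bar>(LINT t:cell h i|N2. t) - k * measure N2 (cell h i)\<bar> \<le> h * (norm p * norm r)"
      using cell_integral_estimate[OF sets(1) finN(1) int(1) h, of i]
        cell_integral_estimate[OF sets(2) finN(2) int(2) h, of i] unfolding k_def by auto
    have "k * measure N1 (cell h i) - k * measure N2 (cell h i) = k * \<nu> (cell h i)"
      using m12[OF cell_sets, of h i] by (simp flip: right_diff_distrib)
    \<comment> \<open>Three errors: one for each Jordan part and one for replacing \<open>A\<close>
      by the grid point on the cell.\<close>
    then have "\<bar>(LINT t:cell h i|N1. t) - (LINT t:cell h i|N2. t) - inner r (A x)\<bar> \<le> 3 * (h * (norm p * norm r))"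
      using e3 b3 b12 by linarith
    also have "\<dots> = h * (3 * (norm p * norm r))" by simp
    also have "\<dots> \<le> h * (2 * ((norm p)\<^sup>2 + (norm r)\<^sup>2))"
    proof (intro mult_left_mono)
      have 1: "2 * (norm p * norm r) \<le> (norm p)\<^sup>2 + (norm r)\<^sup>2"
        using sum_squares_bound[of "norm p" "norm r"] by (simp add: mult.assoc)
      have 2: "3 * m \<le> 2 * s" if "2 * m \<le> s" "0 \<le> s" for m s :: real
        using that by linarith
      show "3 * (norm p * norm r) \<le> 2 * ((norm p)\<^sup>2 + (norm r)\<^sup>2)"
        by (rule 2[OF 1]) simp
    qed (use h in simp)
    finally show "\<bar>(LINT t:cell h i|N1. t) - (LINT t:cell h i|N2. t) - inner (P (cell h i) y) (A x)\<bar>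
      \<le> h * (2 * ((norm (P (cell h i) x))\<^sup>2 + (norm (P (cell h i) y))\<^sup>2))"
      unfolding p_def r_def .
  qed
  have "\<bar>c - inner y (A x)\<bar> \<le> 0"
  proof (rule tendsto_lowerbound)
    show "((\<lambda>h. h * (2 * ((norm x)\<^sup>2 + (norm y)\<^sup>2))) \<longlongrightarrow> 0) (at_right 0)"
      by (auto intro!: tendsto_eq_intros)
    show "\<forall>\<^sub>F h in at_right 0. \<bar>c - inner y (A x)\<bar> \<le> h * (2 * ((norm x)\<^sup>2 + (norm y)\<^sup>2))"
      using le by (auto simp: eventually_at_right_field intro: exI[of _ 1])
  qed simp
  then have "inner y (A x) = c" by simp
  then show ?thesis
    using int unfolding has_signed_integral_def c_def N1_def N2_def \<nu>_def by (simp add: id_def)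
qed

end

section \<open>Scalars\<close>

context hilbert_space
begin

lemma emb_eq_iff: "emb a = emb (b :: 'k) \<longleftrightarrow> a = b"
  using inj_emb by (auto dest: injD)

lemma cnj_scalar: "\<exists>b :: 'k. emb b = cnj (emb (a :: 'k))"
proof -
  have "cnj (emb a) \<in> range (emb :: 'k \<Rightarrow> complex)"
    using range_emb Reals_cnj_iff by (metis UNIV_I rangeI)
  then show ?thesis by (metis rangeE)
qed

lemma scale_adjoint_pair: "\<exists>b. adjoint_pair (scale a) (scale b)"
proof -
  obtain b :: 'k where b: "emb b = cnj (emb a)" using cnj_scalar by blast
  have "inner (scale a x) y = inner x (scale b y)" for x y
  proof -
    have "inner x (scale b y) = Re (cnj (emb (ip (scale b y) x)))"
      by (subst Re_ip[symmetric], subst ip_commute) simp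
    also have "\<dots> = Re (emb a * emb (ip x y))"
      by (simp add: ip_scale_left emb_mult b ip_commute[of y x])
    also have "\<dots> = inner (scale a x) y"
      by (simp add: Re_ip[symmetric] ip_scale_left emb_mult)
    finally show ?thesis ..
  qed
  then show ?thesis unfolding adjoint_pair_def by blast
qed

text \<open>Multiplication by \<open>- \<i>\<close> turns the imaginary part into a real part; over
  the reals the imaginary part vanishes and \<open>j = 0\<close> serves. Statements about
  \<open>ip\<close> thus reduce to \<open>inner\<close> and one scalar.\<close>

lemma Im_ip: "\<exists>j. \<forall>x y. Im (emb (ip x y)) = inner (scale j x) y"
proof (cases "range (emb :: 'k \<Rightarrow> complex) = UNIV")
  case True
  then obtain j :: 'k where j: "emb j = - \<i>" by (metis UNIV_I rangeE)
  have "Im (emb (ip x y)) = inner (scale j x) y" for x y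
    by (simp add: Re_ip[symmetric] ip_scale_left emb_mult j)
  then show ?thesis by blast
next
  case False
  then have "range (emb :: 'k \<Rightarrow> complex) = \<real>" using range_emb by blast
  then have "Im (emb (ip x y)) = inner (scale 0 x) y" for x y
    using complex_is_Real_iff by auto
  then show ?thesis by blast
qed

text \<open>The domain is invariant under scalars, so testing with \<open>scale j x\<close> recovers
  the imaginary part of the identity.\<close>

lemma adjoint_witness_iff:
  assumes "linear_operator A"
  shows "adjoint_witness A y z \<longleftrightarrow> (\<forall>x\<in>dom A. inner (the (A x)) y = inner x z)"
proof
  assume "adjoint_witness A y z"
  then show "\<forall>x\<in>dom A. inner (the (A x)) y = inner x z"
    unfolding adjoint_witness_def by (metis Re_ip)
next
  assume *: "\<forall>x\<in>dom A. inner (the (A x)) y = inner x z"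
  obtain j where j: "\<And>u v. Im (emb (ip u v)) = inner (scale j u) v" using Im_ip by blast
  show "adjoint_witness A y z"
    unfolding adjoint_witness_def
  proof
    fix x assume x: "x \<in> dom A"
    have "scale j x \<in> dom A" "the (A (scale j x)) = scale j (the (A x))"
      using assms x subspace_scale unfolding linear_operator_def by blast+
    then have "inner (scale j (the (A x))) y = inner (scale j x) z" using * by metis
    then have "emb (ip (the (A x)) y) = emb (ip x z)"
      using * x by (intro complex_eqI) (simp_all add: Re_ip j)
    then show "ip (the (A x)) y = ip x z" by (simp add: emb_eq_iff)
  qed
qed

lemma self_adjoint_real:
  assumes "self_adjoint A"
  shows "real_self_adjoint (dom A) (\<lambda>x. the (A x))"
proof
  have lin: "linear_operator A" and dense: "closure (dom A) = UNIV" and adj: "adjoint_operator A = A"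
    using assms unfolding self_adjoint_def densely_defined_def by auto
  show "closure (dom A) = UNIV" by (rule dense)
  fix y z
  \<comment> \<open>Density of the domain makes the \<open>THE\<close> in
    \<open>adjoint_operator\<close> meaningful.\<close>
  have unique: "z = z'" if "adjoint_witness A y z" "adjoint_witness A y z'" for z z'
  proof -
    have "inner x (z - z') = 0" if "x \<in> dom A" for x
      using \<open>adjoint_witness A y z\<close> \<open>adjoint_witness A y z'\<close> that
      unfolding adjoint_witness_iff[OF lin] by (simp add: inner_diff_right)
    then have "dom A \<subseteq> {x. inner x (z - z') = 0}" by blast
    then have "closure (dom A) \<subseteq> {x. inner x (z - z') = 0}"
      by (rule closure_minimal) (intro closed_Collect_eq continuous_intros)
    then have "inner (z - z') (z - z') = 0" unfolding dense by blast
    then show ?thesis by simp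
  qed
  have "y \<in> dom A \<and> the (A y) = z \<longleftrightarrow> A y = Some z" by auto
  also have "\<dots> \<longleftrightarrow> adjoint_operator A y = Some z" unfolding adj ..
  also have "\<dots> \<longleftrightarrow> adjoint_witness A y z"
  proof
    assume "adjoint_operator A y = Some z"
    then obtain z' where "adjoint_witness A y z'" "(THE z. adjoint_witness A y z) = z"
      unfolding adjoint_operator_def by (auto split: if_splits)
    then show "adjoint_witness A y z" using unique by (metis the_equality)
  next
    assume "adjoint_witness A y z"
    then show "adjoint_operator A y = Some z"
      unfolding adjoint_operator_def using unique by (auto intro!: the_equality)
  qed
  also have "\<dots> \<longleftrightarrow> (\<forall>x\<in>dom A. inner (the (A x)) y = inner x z)" by (rule adjoint_witness_iff[OF lin])
  finally show "y \<in> dom A \<and> the (A y) = z \<longleftrightarrow> (\<forall>x\<in>dom A. inner (the (A x)) y = inner x z)" .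
qed

lemma spectral_theorem:
  assumes A: "self_adjoint A"
  shows "\<exists>P. projection_valued_measure P \<and> A = pvm_integral P id"
proof -
  interpret real_self_adjoint "dom A" "\<lambda>x. the (A x)" by (rule self_adjoint_real[OF A])
  have comm_scale: "comm (scale a)" for a
    using A subspace_scale unfolding self_adjoint_def linear_operator_def comm_def by blast
  \<comment> \<open>Multiplication by a scalar and by its conjugate form an adjoint pair, and both
    commute with \<open>A\<close>; the bicommutant property therefore gives linearity over
    \<open>'k\<close>.\<close>
  have P_scale: "P V (scale a x) = scale a (P V x)" if "V \<in> sets borel" for V a x
    using scale_adjoint_pair[of a] bicommD[OF P_bicomm[OF that] _ comm_scale comm_scale] by blast
  obtain j where j: "\<And>u v. Im (emb (ip u v)) = inner (scale j u) v" using Im_ip by blast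
  have "projection_valued_measure P"
    unfolding projection_valued_measure_def
  proof (intro conjI ballI allI impI)
    fix V :: "real set" assume V: "V \<in> sets borel"
    have lin: "Vector_Spaces.linear scale scale (P V)"
      by unfold_locales (simp_all add: P_scale[OF V] linear_add[OF P_linear[OF V]])
    have ran: "range (P V) = {x. P V x = x}"
      using P_idem[OF V] by (auto intro: rangeI) (metis rangeI)
    show "\<exists>E. subspace E \<and> closed E \<and> is_proj E (P V)"
    proof (intro exI conjI)
      show "subspace (range (P V))"
        unfolding ran subspace_def
        by (simp add: P_scale[OF V] linear_add[OF P_linear[OF V]] linear_0[OF P_linear[OF V]])
      have "continuous_on UNIV (P V)"
        using linear_continuous_on orth_proj_bounded_linear P_proj[OF V] by blast
      then show "closed (range (P V))"
        unfolding ran by (intro closed_Collect_eq continuous_intros)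
      have "ip (P V x) y = ip x (P V y)" for x y
      proof -
        have "emb (ip (P V x) y) = emb (ip x (P V y))"
          by (intro complex_eqI)
            (simp_all add: Re_ip j P_inner[OF V] P_scale[OF V, symmetric])
        then show ?thesis by (simp add: emb_eq_iff)
      qed
      then show "is_proj (range (P V)) (P V)"
        unfolding is_proj_def using lin P_idem[OF V] by (auto simp: fun_eq_iff)
    qed
  next
    show "P {} = (\<lambda>x. 0)" by (rule P_empty)
    show "P UNIV = id" by (rule P_UNIV)
    show "P (V \<inter> W) = P V \<circ> P W" if "V \<in> sets borel" "W \<in> sets borel" for V W
      using P_Int[OF that] by (simp add: fun_eq_iff)
    show "(\<lambda>n. P (V n) x) sums P (\<Union>n. V n) x"
      if "range V \<subseteq> sets borel" "disjoint_family V" for V :: "nat \<Rightarrow> real set" and x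
      by (rule P_sums[OF that])
  qed
  moreover have "pvm_integral P id = A"
  proof (rule pvm_integral_eqI)
    have mu: "pvm_pos_measure P x = mu x" for x
    proof -
      have "pvm_pos_measure P x = measure_of (space (mu x)) (sets (mu x)) (emeasure (mu x))"
        unfolding pvm_pos_measure_def space_mu sets_mu
      proof (rule measure_of_eq)
        fix V :: "real set" assume "V \<in> sigma_sets UNIV (sets borel)"
        then have "V \<in> sets borel" using sets.sigma_sets_eq[of "borel :: real measure"] by simp
        then show "ennreal (Re (emb (pvm_measure P x x V))) = emeasure (mu x) V"
          by (simp add: pvm_measure_def Re_ip emeasure_mu norm_P_square)
      qed simp
      then show ?thesis by (simp only: measure_of_of_measure)
    qed
    show "is_pvm_integral P id A"
      unfolding is_pvm_integral_def
    proof (intro conjI ballI allI A)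
      show "dom A = {x. (\<integral>\<^sup>+t. ennreal (\<bar>id t\<bar>\<^sup>2) \<partial>pvm_pos_measure P x) < \<infinity>}"
        unfolding mu using D_iff by auto
      fix x y assume x: "x \<in> dom A"
      have "has_signed_integral id (\<lambda>V. inner (scale j (P V y)) x) (inner (scale j y) (the (A x)))"
      proof -
        \<comment> \<open>\<open>P\<close> is known to commute with \<open>scale j\<close> on Borel
          sets only, so the two set functions may differ elsewhere. The Jordan parts evaluate them
          on Borel sets alone, which permits moving \<open>scale j\<close> onto \<open>y\<close> for
          the imaginary part.\<close>
        have eq: "has_signed_integral id \<nu> c \<longleftrightarrow> has_signed_integral id \<nu>' c"
          if "\<And>V. V \<in> sets borel \<Longrightarrow> \<nu> V = \<nu>' V" for \<nu> \<nu>' c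
        proof -
          have "(SUP W\<in>{W \<in> sets borel. W \<subseteq> V}. ennreal (\<nu> W)) = (SUP W\<in>{W \<in> sets borel. W \<subseteq> V}. ennreal (\<nu>' W))"
            "(SUP W\<in>{W \<in> sets borel. W \<subseteq> V}. ennreal (- \<nu> W)) = (SUP W\<in>{W \<in> sets borel. W \<subseteq> V}. ennreal (- \<nu>' W))" for V
            by (intro SUP_cong; simp add: that)+
          then have "positive_part \<nu> = positive_part \<nu>'" "negative_part \<nu> = negative_part \<nu>'"
            unfolding negative_part_def positive_part_def by simp_all
          then show ?thesis unfolding has_signed_integral_def by simp
        qed
        show ?thesis
          by (subst eq[where \<nu>' = "\<lambda>V. inner (P V (scale j y)) x"])
            (simp_all add: P_scale signed_integral[OF x])
      qed
      then show "has_cmeasure_integral id (\<lambda>V. emb (pvm_measure P y x V)) (emb (ip y (the (A x))))"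
        unfolding has_cmeasure_integral_def pvm_measure_def Re_ip j
        using signed_integral[OF x] by blast
    qed
  qed
  ultimately show ?thesis by metis
qed

end

theorem theorem5p2:
  fixes scale :: "'k::real_or_complex \<Rightarrow> 'h::{real_inner, complete_space} \<Rightarrow> 'h"
    and ip :: "'h \<Rightarrow> 'h \<Rightarrow> 'k"
    and A :: "'h \<rightharpoonup> 'h"
  assumes "hilbert_space scale ip"
    and "hilbert_space.infinite_dimensional scale"
    and "separable_space (euclidean :: 'h topology)"
    and "hilbert_space.self_adjoint scale ip A"
  shows "\<exists>P. hilbert_space.projection_valued_measure scale ip P \<and>
             A = hilbert_space.pvm_integral scale ip P id"
  using hilbert_space.spectral_theorem[OF assms(1,4)] .

end
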